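(* Let $\Lambda$ be a finitely generated semigroup as in the context, $R=\mathbf C[[\Lambda]]$, and let $\underline\nu=(\nu_1,\dots,\nu_r)$ be a sequence of monomial valuations of $R$ with $\nu_1$ centered at the origin. Then the Poincaré series of the affine toric germ $(Z^\Lambda,0)$ relative to $\underline\nu$ satisfies $$P^{\underline\nu}_{(Z^\Lambda,0)}=\int_{\mathbf P R}\underline t^{\,\underline\nu}\,d\chi ,$$ where the right-hand side is the integral with respect to the Euler characteristic of the function $\underline t^{\,\underline\nu}:\mathbf PR\to\mathbf Z[[t_1,\dots,t_r]]$, $h\mapsto t_1^{\nu_1(h)}\cdots t_r^{\nu_r(h)}$.
   Context: $\Lambda$ is a finitely generated sub-semigroup (with $0$) of a rank $d$ lattice $M=\Lambda+(-\Lambda)$; $N$ is the dual lattice; $\sigma\subset N_{\mathbf R}$ is the cone whose dual is $\sigma^\vee=\mathbf R_{\ge0}\Lambda$. It is assumed that $\sigma^\vee$ has a vertex, i.e. the affine toric variety $Z^\Lambda=\mathrm{Spec}\,\mathbf C[\Lambda]$ has a zero-dimensional orbit, denoted $0$. A non-zero $v\in\sigma\cap N$ defines a monomial valuation $\nu(\sum c_uX^u)=\min_{c_u\neq0}\langle v,u\rangle$; it is centered at the origin when $v\in\stackrel{\circ}{\sigma}$ (the interior). Let $\nu_i$ correspond to $v_i\in\sigma\cap N$. **Poincaré series.** Put $\mathrm{gr}_{\nu_1}R=\bigoplus_aI(a)/I(a+1)$, $I(a)=\{\phi\in R:\nu_1(\phi)\ge a\}$. Each other $\nu_i$ induces a valuation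 on it: on a non-zero homogeneous $\bar h\in I(a)/I(a+1)$ its value is $\max\{\nu_i(h):h+I(a+1)=\bar h\}$, and on a sum of non-zero homogeneous terms it is the minimum of the values. The induced valuations have homogeneous valuation ideals; taking successively associated graded rings with respect to the valuations induced by $\nu_2,\dots,\nu_r$ (inducing the remaining valuations at each step in the same way) gives a $\mathbf Z^r_{\ge0}$-graded ring $\mathrm{gr}_{\underline\nu}R=\bigoplus_{\underline a}J(\underline a)$ with finite-dimensional components. Then $P^{\underline\nu}_{(Z^\Lambda,0)}=\sum_{\underline a\in\mathbf Z^r_{\ge0}}\chi(\mathbf PJ(\underline a))\,\underline t^{\underline a}\in\mathbf Z[[\underline t]]$, where $\mathbf PL$ is the projectivization of a vector space $L$ and $\chi(\mathbf PL)=\dim_{\mathbf C}L$ when $L$ is finite-dimensional. **Integration.** For $k\ge0$ let $\mathcal J_R^k=R/I_{\nu_1}(k+1)$, $I_{\nu_1}(k+1)=\{\phi\in R:\nu_1(\phi)\ge k+1\}$; it is a finite-dimensional vector space. $\mathbf P^*L$ is the disjoint union of $\mathbf PL$ and a point $*$; $\pi_k:\mathbf PR\to\mathbf P^*\mathcal J^k_R$ is the natural map (classes with zero $k$-jet go to $*$). A subset $X\subset\mathbf PR$ is cylindric if $X=\pi_k^{-1}(Y)$ for some $k$ and some constructible $Y\subset\mathbf P\mathcal J^k_R\subset\mathbf P^*\mathcal J^k_R$, and then $\chi(X):=\chi(Y)$ (this is independent of choices). A function $\Phi:\mathbf PR\to G$ to an abelian group is cylindric if $\Phi^{-1}(g)$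 is cylindric for every $g\ne0$; its integral is $\int_{\mathbf PR}\Phi\,d\chi:=\sum_{g\in\Phi(\mathbf PR),\,g\ne0}\chi(\Phi^{-1}(g))\,g$ when this sum makes sense in $G$. Here $G=\mathbf Z[[\underline t]]$.
   Formalization: If some ν_i (i≥2) is not centered at the origin, fibres of t^ν need not be cylindric and the integral is undefined; there χ of a non-cylindric set X is taken as the eventual value of χ(X∩PR_k), R_k the polynomials with <v_1,u>≤k. On cylindric sets χ is as defined. *)

theory Defs
  imports "HOL-Analysis.Analysis" "HOL-Homology.Homology"
begin

section \<open>The semigroup and its cones\<close>

text \<open>
  The rank \<open>d\<close> lattice \<open>M\<close> is \<open>\<int>\<^sup>d\<close>, written \<^typ>\<open>int ^ 'd\<close>; the dual lattice \<open>N\<close> is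
  identified with \<^typ>\<open>int ^ 'd\<close> through the standard pairing.
\<close>

definition pairing :: "int ^ 'd \<Rightarrow> int ^ 'd \<Rightarrow> int" where
  "pairing v u = (\<Sum>i\<in>UNIV. v $ i * u $ i)"

definition real_vec :: "int ^ 'd \<Rightarrow> real ^ 'd" where
  "real_vec u = (\<chi> i. real_of_int (u $ i))"

definition fg_semigroup :: "(int ^ 'd) set \<Rightarrow> bool" where
  "fg_semigroup \<Lambda> \<longleftrightarrow>
     (\<exists>F. finite F \<and> \<Lambda> = {(\<Sum>u\<in>F. int (n u) *s u) | n :: int ^ 'd \<Rightarrow> nat. True})"

definition sigma_dual :: "(int ^ 'd) set \<Rightarrow> (real ^ 'd) set" where
  "sigma_dual \<Lambda> = convex_cone hull (real_vec ` \<Lambda>)"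

text \<open>By biduality of closed convex cones this is the unique such cone with dual \<^term>\<open>sigma_dual \<Lambda>\<close>.\<close>

definition sigma_cone :: "(int ^ 'd) set \<Rightarrow> (real ^ 'd) set" where
  "sigma_cone \<Lambda> = {w. \<forall>x\<in>sigma_dual \<Lambda>. 0 \<le> w \<bullet> x}"


section \<open>Formal power series and monomial valuations\<close>

text \<open>
  An element \<open>\<Sum> c\<^sub>u X\<^sup>u\<close> of \<open>\<complex>[[\<Lambda>]]\<close> is its coefficient function. Neither the filtrations nor the
  projectivizations below involve the product, so only the vector space structure appears.
\<close>

type_synonym 'u series = "'u \<Rightarrow> complex"

definition power_series :: "'u set \<Rightarrow> 'u series set" where
  "power_series \<Lambda> = {h. \<forall>u. h u \<noteq> 0 \<longrightarrow> u \<in> \<Lambda>}"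

text \<open>
  The value of the zero series is \<open>\<infinity>\<close>. For \<open>v \<in> \<sigma> \<inter> N\<close> the pairing is non-negative on \<open>\<Lambda>\<close>, so
  \<^const>\<open>nat\<close> loses nothing, and the infimum over a non-empty support is attained.
\<close>

definition mon_val :: "int ^ 'd \<Rightarrow> (int ^ 'd) series \<Rightarrow> enat" where
  "mon_val v h = (INF u\<in>{u. h u \<noteq> 0}. enat (nat (pairing v u)))"

definition val_ideal :: "(int ^ 'd) set \<Rightarrow> int ^ 'd \<Rightarrow> nat \<Rightarrow> (int ^ 'd) series set" where
  "val_ideal \<Lambda> v a = {h \<in> power_series \<Lambda>. enat a \<le> mon_val v h}"


section \<open>Projectivization of a subquotient\<close>

text \<open>
  For vector spaces \<open>B \<subseteq> A\<close> of series, the point of \<open>\<P>(A/B)\<close> given by \<open>h \<in> A - B\<close> is represented by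
  the union of the cosets \<open>c h + B\<close>, \<open>c \<noteq> 0\<close>. Thus \<open>\<P>(A/B)\<close> is a quotient set of \<open>A - B\<close>, and its
  topology is the quotient topology coming from the coefficientwise topology on series. On a
  finite-dimensional \<open>A/B\<close>, with \<open>A\<close> and \<open>B\<close> closed, this is the classical topology.
\<close>

definition proj_class :: "'u series set \<Rightarrow> 'u series \<Rightarrow> 'u series set" where
  "proj_class B h = {g. \<exists>c. c \<noteq> 0 \<and> (\<lambda>u. g u - c * h u) \<in> B}"

definition proj_space :: "'u series set \<Rightarrow> 'u series set \<Rightarrow> 'u series set set" where
  "proj_space A B = proj_class B ` (A - B)"

definition quotient_top :: "'a topology \<Rightarrow> ('a \<Rightarrow> 'b) \<Rightarrow> 'b topology" where
  "quotient_top X q =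
     topology (\<lambda>U. U \<subseteq> q ` topspace X \<and> openin X {x \<in> topspace X. q x \<in> U})"

definition proj_top :: "'u series set \<Rightarrow> 'u series set \<Rightarrow> 'u series set topology" where
  "proj_top A B = quotient_top (top_of_set (A - B)) (proj_class B)"

definition linear_functional :: "('u series \<Rightarrow> complex) \<Rightarrow> bool" where
  "linear_functional f \<longleftrightarrow>
     (\<forall>g h. f (\<lambda>u. g u + h u) = f g + f h) \<and> (\<forall>c h. f (\<lambda>u. c * h u) = c * f h)"

text \<open>
  Homogeneous polynomial functions on \<open>A/B\<close>: every linear functional on \<open>A/B\<close> extends to a functional
  on all series vanishing on \<open>B\<close>.
\<close>

inductive hom_poly :: "'u series set \<Rightarrow> nat \<Rightarrow> ('u series \<Rightarrow> complex) \<Rightarrow> bool" for B where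
  const: "hom_poly B 0 (\<lambda>h. c)"
| linear: "linear_functional f \<Longrightarrow> (\<And>h. h \<in> B \<Longrightarrow> f h = 0) \<Longrightarrow> hom_poly B 1 f"
| add: "hom_poly B n f \<Longrightarrow> hom_poly B n g \<Longrightarrow> hom_poly B n (\<lambda>h. f h + g h)"
| mult: "hom_poly B m f \<Longrightarrow> hom_poly B n g \<Longrightarrow> hom_poly B (m + n) (\<lambda>h. f h * g h)"

text \<open>
  For finite-dimensional \<open>A/B\<close>, constructible means in the Boolean algebra generated by the
  Zariski closed sets; each of these is a finite intersection of hypersurfaces.
\<close>

inductive constructible ::
  "'u series set \<Rightarrow> 'u series set \<Rightarrow> 'u series set set \<Rightarrow> bool" for A B where
  hypersurface: "hom_poly B n f \<Longrightarrow> constructible A B {p \<in> proj_space A B. \<forall>h\<in>p. f h = 0}"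
| union: "constructible A B Y \<Longrightarrow> constructible A B Z \<Longrightarrow> constructible A B (Y \<union> Z)"
| complement: "constructible A B Y \<Longrightarrow> constructible A B (proj_space A B - Y)"


section \<open>Euler characteristic\<close>

text \<open>
  Homology groups are commutative groups in multiplicative notation; the rank is the largest number
  of \<open>\<int>\<close>-independent elements, meant for groups where this is bounded. The Euler characteristic is
  the one of singular homology; for complex constructible sets it agrees with the additive one
  (with compact supports).
\<close>

definition Z_independent :: "('a, 'b) monoid_scheme \<Rightarrow> 'a set \<Rightarrow> bool" where
  "Z_independent G S \<longleftrightarrow> finite S \<and> S \<subseteq> carrier G \<and>
     (\<forall>n :: 'a \<Rightarrow> int. finprod G (\<lambda>x. x [^]\<^bsub>G\<^esub> n x) S = \<one>\<^bsub>G\<^esub> \<longrightarrow> (\<forall>x\<in>S. n x = 0))"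

definition abelian_rank :: "('a, 'b) monoid_scheme \<Rightarrow> nat" where
  "abelian_rank G = (GREATEST n. \<exists>S. Z_independent G S \<and> card S = n)"

definition betti :: "nat \<Rightarrow> 'a topology \<Rightarrow> nat" where
  "betti p X = abelian_rank (homology_group (int p) X)"

definition euler_char :: "'a topology \<Rightarrow> int" where
  "euler_char X = (\<Sum>p | betti p X \<noteq> 0. (- 1) ^ p * int (betti p X))"

definition euler_char_proj :: "'u series set \<Rightarrow> 'u series set \<Rightarrow> 'u series set set \<Rightarrow> int" where
  "euler_char_proj A B Y = euler_char (subtopology (proj_top A B) Y)"


section \<open>The Poincare series\<close>

text \<open>
  Each homogeneous component of an iterated graded ring is a quotient \<open>A/B\<close> of subspaces of \<open>R\<close>, and
  is represented by the pair \<open>(A, B)\<close>. The induced value of a class is the largest value of a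
  representative in \<open>R\<close>: at each step it is the largest value of the classes in the previous graded
  ring mapping to it. The class \<open>B\<close> has value \<open>\<infinity>\<close>. In degree \<open>a\<close> the associated graded space of
  \<open>A/B\<close> is \<open>(A'/B)/(B'/B) = A'/B'\<close>, where \<open>A'/B\<close> and \<open>B'/B\<close> are the valuation ideals of \<open>a\<close> and
  \<open>a + 1\<close>. As the induced valuation on a sum of homogeneous terms is the minimum of the values, the
  associated graded ring is formed separately in each component.
\<close>

definition induced_val ::
  "int ^ 'd \<Rightarrow> (int ^ 'd) series set \<Rightarrow> (int ^ 'd) series \<Rightarrow> enat" where
  "induced_val v B h = (SUP g\<in>{g. (\<lambda>u. g u - h u) \<in> B}. mon_val v g)"

definition gr_step ::
  "int ^ 'd \<Rightarrow> nat \<Rightarrow> (int ^ 'd) series set \<times> (int ^ 'd) series set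
     \<Rightarrow> (int ^ 'd) series set \<times> (int ^ 'd) series set" where
  "gr_step v a AB = (case AB of (A, B) \<Rightarrow>
     ({h \<in> A. enat a \<le> induced_val v B h}, {h \<in> A. enat (a + 1) \<le> induced_val v B h}))"

definition gr_component ::
  "(int ^ 'd) set \<Rightarrow> (int ^ 'd) list \<Rightarrow> nat list
     \<Rightarrow> (int ^ 'd) series set \<times> (int ^ 'd) series set" where
  "gr_component \<Lambda> vs as = fold (\<lambda>(v, a). gr_step v a) (zip vs as) (power_series \<Lambda>, {\<lambda>_. 0})"

text \<open>
  Elements of \<open>\<int>[[t\<^sub>1,\<dots>,t\<^sub>r]]\<close> are coefficient functions on exponents, the exponents being lists of
  length \<open>r\<close>; coefficients at lists of any other length are \<open>0\<close>.
\<close>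

type_synonym multi_series = "nat list \<Rightarrow> int"

definition t_monomial :: "nat list \<Rightarrow> multi_series" where
  "t_monomial a = (\<lambda>b. if b = a then 1 else 0)"

definition poincare_series :: "(int ^ 'd) set \<Rightarrow> (int ^ 'd) list \<Rightarrow> multi_series" where
  "poincare_series \<Lambda> vs = (\<lambda>as. if length as = length vs
     then (case gr_component \<Lambda> vs as of (A, B) \<Rightarrow> euler_char_proj A B (proj_space A B))
     else 0)"


section \<open>Integration over \<open>\<P>R\<close>\<close>

abbreviation PR :: "(int ^ 'd) set \<Rightarrow> (int ^ 'd) series set set" where
  "PR \<Lambda> \<equiv> proj_space (power_series \<Lambda>) {\<lambda>_. 0}"

text \<open>The point \<open>*\<close> of \<open>\<P>\<^sup>*L\<close> is \<^const>\<open>None\<close>.\<close>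

definition jet_map ::
  "(int ^ 'd) set \<Rightarrow> int ^ 'd \<Rightarrow> nat \<Rightarrow> (int ^ 'd) series set \<Rightarrow> (int ^ 'd) series set option" where
  "jet_map \<Lambda> v k p = (let I = val_ideal \<Lambda> v (k + 1) in
     if p \<subseteq> I then None else Some (\<Union>h\<in>p. proj_class I h))"

definition is_cylinder_over ::
  "(int ^ 'd) set \<Rightarrow> int ^ 'd \<Rightarrow> (int ^ 'd) series set set \<Rightarrow> nat \<Rightarrow> (int ^ 'd) series set set \<Rightarrow> bool"
  where
  "is_cylinder_over \<Lambda> v X k Y \<longleftrightarrow>
     constructible (power_series \<Lambda>) (val_ideal \<Lambda> v (k + 1)) Y \<and>
     X = {p \<in> PR \<Lambda>. jet_map \<Lambda> v k p \<in> Some ` Y}"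

definition cylindric ::
  "(int ^ 'd) set \<Rightarrow> int ^ 'd \<Rightarrow> (int ^ 'd) series set set \<Rightarrow> bool" where
  "cylindric \<Lambda> v X \<longleftrightarrow> (\<exists>k Y. is_cylinder_over \<Lambda> v X k Y)"

definition chi_cyl :: "(int ^ 'd) set \<Rightarrow> int ^ 'd \<Rightarrow> (int ^ 'd) series set set \<Rightarrow> int" where
  "chi_cyl \<Lambda> v X = (THE e. \<exists>k Y. is_cylinder_over \<Lambda> v X k Y \<and>
     e = euler_char_proj (power_series \<Lambda>) (val_ideal \<Lambda> v (k + 1)) Y)"

text \<open>
  When some valuation is not centered at the origin, the fibres of \<open>t\<^sup>\<nu>\<close> need not be cylindric: for
  \<open>\<Lambda> = \<nat>\<^sup>2\<close>, \<open>v\<^sub>1 = (1,1)\<close>, \<open>v\<^sub>2 = (1,0)\<close> the fibre over \<open>t\<^sub>1 t\<^sub>2\<close> contains \<open>x\<close> but, for all \<open>k\<close>, not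
  \<open>x + y\<^sup>k\<^sup>+\<^sup>1\<close>, although the two have the same \<open>k\<close>-jet. For such subsets \<open>X\<close> the Euler
  characteristic is understood as the eventually constant value, if any, of \<open>\<chi>(X \<inter> \<P>R\<^sub>k)\<close> with \<open>R\<^sub>k\<close>
  the finite-dimensional space of polynomials supported in \<open>{u. \<langle>v\<^sub>1, u\<rangle> \<le> k}\<close>. The natural map from
  \<open>R\<^sub>k\<close> to the \<open>k\<close>-jets is an isomorphism. If \<open>X\<close> is the cylinder over \<open>Y\<close> in the \<open>k\<close>-jets, it
  identifies \<open>X \<inter> \<P>R\<^sub>k\<close> with \<open>Y\<close>, and \<open>X \<inter> \<P>R\<^sub>l\<close>, \<open>l \<ge> k\<close>, is a vector bundle over \<open>Y\<close>; so on
  cylindric sets this value is \<^const>\<open>chi_cyl\<close>.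
\<close>

definition truncated_series :: "(int ^ 'd) set \<Rightarrow> int ^ 'd \<Rightarrow> nat \<Rightarrow> (int ^ 'd) series set" where
  "truncated_series \<Lambda> v k = {h \<in> power_series \<Lambda>. \<forall>u. h u \<noteq> 0 \<longrightarrow> pairing v u \<le> int k}"

definition chi_trunc :: "(int ^ 'd) set \<Rightarrow> int ^ 'd \<Rightarrow> (int ^ 'd) series set set \<Rightarrow> int" where
  "chi_trunc \<Lambda> v X = (THE e. \<forall>\<^sub>F k in sequentially.
     (let A = truncated_series \<Lambda> v k; Y = X \<inter> proj_space A {\<lambda>_. 0} in
        constructible A {\<lambda>_. 0} Y \<and> euler_char_proj A {\<lambda>_. 0} Y = e))"

definition chi_PR :: "(int ^ 'd) set \<Rightarrow> int ^ 'd \<Rightarrow> (int ^ 'd) series set set \<Rightarrow> int" where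
  "chi_PR \<Lambda> v X = (if cylindric \<Lambda> v X then chi_cyl \<Lambda> v X else chi_trunc \<Lambda> v X)"

definition fibre ::
  "(int ^ 'd) set \<Rightarrow> ((int ^ 'd) series set \<Rightarrow> multi_series) \<Rightarrow> multi_series
     \<Rightarrow> (int ^ 'd) series set set" where
  "fibre \<Lambda> \<Phi> g = {p \<in> PR \<Lambda>. \<Phi> p = g}"

definition cylindric_fun ::
  "(int ^ 'd) set \<Rightarrow> int ^ 'd \<Rightarrow> ((int ^ 'd) series set \<Rightarrow> multi_series) \<Rightarrow> bool" where
  "cylindric_fun \<Lambda> v \<Phi> \<longleftrightarrow> (\<forall>g. g \<noteq> (\<lambda>_. 0) \<longrightarrow> cylindric \<Lambda> v (fibre \<Lambda> \<Phi> g))"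

text \<open>
  The sum over the values of \<open>\<Phi>\<close> makes sense in \<open>\<int>[[t]]\<close> when only finitely many summands
  contribute to each coefficient.
\<close>

definition contributing_values ::
  "(int ^ 'd) set \<Rightarrow> int ^ 'd \<Rightarrow> ((int ^ 'd) series set \<Rightarrow> multi_series) \<Rightarrow> nat list
     \<Rightarrow> multi_series set" where
  "contributing_values \<Lambda> v \<Phi> a =
     {g \<in> \<Phi> ` PR \<Lambda>. g \<noteq> (\<lambda>_. 0) \<and> chi_PR \<Lambda> v (fibre \<Lambda> \<Phi> g) * g a \<noteq> 0}"

definition euler_summable ::
  "(int ^ 'd) set \<Rightarrow> int ^ 'd \<Rightarrow> ((int ^ 'd) series set \<Rightarrow> multi_series) \<Rightarrow> bool" where
  "euler_summable \<Lambda> v \<Phi> \<longleftrightarrow> (\<forall>a. finite (contributing_values \<Lambda> v \<Phi> a))"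

definition euler_integral ::
  "(int ^ 'd) set \<Rightarrow> int ^ 'd \<Rightarrow> ((int ^ 'd) series set \<Rightarrow> multi_series) \<Rightarrow> multi_series" where
  "euler_integral \<Lambda> v \<Phi> =
     (\<lambda>a. \<Sum>g\<in>contributing_values \<Lambda> v \<Phi> a. chi_PR \<Lambda> v (fibre \<Lambda> \<Phi> g) * g a)"

text \<open>All representatives of a point of \<open>\<P>R\<close> are proportional, hence have the same values.\<close>

definition t_nu :: "(int ^ 'd) list \<Rightarrow> (int ^ 'd) series set \<Rightarrow> multi_series" where
  "t_nu vs p = t_monomial (map (\<lambda>v. the_enat (mon_val v (SOME h. h \<in> p))) vs)"

end

(*
  Both sides have at t^a the coefficient |W_a|, where W_a is the set of u in Lambda with
  <v_i,u> = a_i for all i. For the Poincare series this holds because a graded component has the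
  monomials X^u, u in W_a, as a basis. A fibre of t^nu is described inside the projective space of
  a finite set T of monomials by conditions "some coordinate in T_i is non-zero", with T_i the
  part of T where <v_i,u> = a_i, so what is needed is that the Euler characteristic of such an open
  set is the cardinality of the intersection of the T_i.

  By Mayer-Vietoris the condition for T_i = A + {w} can be traded for those for A, for {w} and for
  both, which reduces everything to singletons T_i, that is, to tori. The projectivized torus of
  one coordinate is contractible. With two or more coordinates, cut C^* (the range of a
  quotient of two coordinates) into two slit planes meeting in two half planes: all four regions are
  star-shaped, so the pieces are homotopy equivalent to the torus with one coordinate fewer and
  Mayer-Vietoris gives 2e - 2e = 0.
*)
theory Submission
  imports Defs
begin

section \<open>Ranks of abelian groups\<close>

text \<open>The Euler characteristic is that of singular homology, so its additivity has to be
  extracted from exact sequences. Ranks there may be infinite and the alternating sum may fail to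
  terminate; finiteness is therefore carried along with every value, and each exact-sequence
  argument proves it together with the formula. The spaces concerned are quotients of possibly
  infinite-dimensional spaces of series. Working upstairs, on cones of series that are unions of
  classes, avoids coordinates on the quotients: a deformation that is linear in the series descends
  to classes. Keeping a denominator \<open>Q\<close> and free coordinates in these cones lets one
  count serve graded components, jets and truncations alike. A further obstacle is that a fibre need
  not be a cylinder if some valuation is not centered at the origin, since terms of arbitrarily high
  \<open>v1\<close>-weight can then change the other values. Both branches of \<open>chi_PR\<close>
  have to be computed, and the agreement of their values makes a common formula possible.\<close>

text \<open>
  Ranks are attached to subsets of a group rather than to subgroups, so that exactness, an equation
  between an image and a kernel, identifies them without passing to a new group.
\<close>

definition fin_rk :: "('a, 'b) monoid_scheme \<Rightarrow> 'a set \<Rightarrow> bool" where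
  "fin_rk G K \<longleftrightarrow> (\<exists>N. \<forall>S\<subseteq>K. Z_independent G S \<longrightarrow> card S \<le> N)"

text \<open>\<open>GREATEST\<close> carries information only when the cardinalities are bounded, so
  \<open>rk\<close> is meant to be used together with \<open>fin_rk\<close>.\<close>

definition rk :: "('a, 'b) monoid_scheme \<Rightarrow> 'a set \<Rightarrow> nat" where
  "rk G K = (GREATEST n. \<exists>S\<subseteq>K. Z_independent G S \<and> card S = n)"

lemma abelian_rank_eq_rk: "abelian_rank G = rk G (carrier G)"
proof -
  have "(\<exists>S. Z_independent G S \<and> card S = n) \<longleftrightarrow> (\<exists>S\<subseteq>carrier G. Z_independent G S \<and> card S = n)" for n
    by (auto simp: Z_independent_def)
  then show ?thesis by (simp add: abelian_rank_def rk_def)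
qed

text \<open>Elimination without division, one equation at a time: an unknown \<open>y\<close> with
  non-zero coefficient is removed by cross-multiplying, and the solution of the smaller system is
  scaled by that coefficient so that the value at \<open>y\<close> is an integer.\<close>

lemma integer_homogeneous_system:
  fixes c :: "'x \<Rightarrow> 'e \<Rightarrow> int"
  assumes "finite E" "finite S" "card E < card S"
  shows "\<exists>z. (\<exists>x\<in>S. z x \<noteq> 0) \<and> (\<forall>e\<in>E. (\<Sum>x\<in>S. z x * c x e) = 0)"
  using assms
proof (induction E arbitrary: S c rule: finite_induct)
  case empty
  then show ?case by (intro exI[of _ "\<lambda>_. 1"]) (auto simp: card_gt_0_iff)
next
  case (insert e E)
  show ?case
  proof (cases "\<forall>x\<in>S. c x e = 0")
    case True
    have "card E < card S" using insert by auto
    from insert.IH[OF insert.prems(1) this, of c] True show ?thesis by auto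
  next
    case False
    then obtain y where y: "y \<in> S" "c y e \<noteq> 0" by auto
    define c' where "c' x e' = c y e * c x e' - c x e * c y e'" for x e'
    have "card E < card (S - {y})" using insert y by (simp add: card_Diff_singleton)
    from insert.IH[OF _ this, of c'] insert.prems obtain z'
      where z': "\<exists>x\<in>S - {y}. z' x \<noteq> 0" "\<And>e'. e'\<in>E \<Longrightarrow> (\<Sum>x\<in>S - {y}. z' x * c' x e') = 0" by auto
    define z where "z x = (if x = y then - (\<Sum>x\<in>S - {y}. z' x * c x e) else c y e * z' x)" for x
    have split: "(\<Sum>x\<in>S. z x * c x e') = z y * c y e' + (\<Sum>x\<in>S - {y}. c y e * z' x * c x e')" for e'
      using insert.prems y by (subst sum.remove[of S y]) (auto simp: z_def intro!: sum.cong)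
    have "(\<Sum>x\<in>S. z x * c x e) = 0"
      unfolding split by (simp add: z_def sum_distrib_left sum_distrib_right mult_ac)
    moreover have "(\<Sum>x\<in>S. z x * c x e') = 0" if "e' \<in> E" for e'
    proof -
      have "0 = (\<Sum>x\<in>S - {y}. z' x * c' x e')" using z'(2)[OF that] by simp
      also have "\<dots> = (\<Sum>x\<in>S. z x * c x e')" unfolding split
        by (simp add: z_def c'_def sum_distrib_left sum_distrib_right algebra_simps sum_subtractf)
      finally show ?thesis by simp
    qed
    moreover have "\<exists>x\<in>S. z x \<noteq> 0" using z'(1) y by (auto simp: z_def)
    ultimately show ?thesis by auto
  qed
qed

section \<open>Independent sets and the maxima of their sizes\<close>

lemma fin_rk_mono: "fin_rk G K \<Longrightarrow> L \<subseteq> K \<Longrightarrow> fin_rk G L"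
  unfolding fin_rk_def by (meson order_trans)

lemma Z_independentD:
  "Z_independent G S \<Longrightarrow> finprod G (\<lambda>x. x [^]\<^bsub>G\<^esub> (n x :: int)) S = \<one>\<^bsub>G\<^esub> \<Longrightarrow> x \<in> S \<Longrightarrow> n x = 0"
  by (simp add: Z_independent_def)

lemma Z_independent_empty: "Z_independent G {}"
  by (simp add: Z_independent_def)

lemma rk_le: assumes "fin_rk G K" "S \<subseteq> K" "Z_independent G S" shows "card S \<le> rk G K"
proof -
  obtain N where "\<forall>S\<subseteq>K. Z_independent G S \<longrightarrow> card S \<le> N" using assms(1) by (auto simp: fin_rk_def)
  then show ?thesis unfolding rk_def using assms(2,3)
    by (intro Greatest_le_nat[where P = "\<lambda>n. \<exists>S\<subseteq>K. Z_independent G S \<and> card S = n" and b = N]) auto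
qed

lemma rk_attained:
  assumes "fin_rk G K" shows "\<exists>S\<subseteq>K. Z_independent G S \<and> card S = rk G K"
proof -
  obtain N where N: "\<forall>S\<subseteq>K. Z_independent G S \<longrightarrow> card S \<le> N" using assms(1) by (auto simp: fin_rk_def)
  have "\<exists>S\<subseteq>K. Z_independent G S \<and> card S = 0" using Z_independent_empty by fastforce
  then show ?thesis unfolding rk_def
    by (rule GreatestI_nat[where P = "\<lambda>n. \<exists>S\<subseteq>K. Z_independent G S \<and> card S = n" and b = N]) (use N in auto)
qed

lemma rk_eqI:
  assumes "\<And>S. S \<subseteq> K \<Longrightarrow> Z_independent G S \<Longrightarrow> card S \<le> n"
    "\<exists>S\<subseteq>K. Z_independent G S \<and> card S = n"
  shows "fin_rk G K" "rk G K = n"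
  using assms unfolding fin_rk_def rk_def by (auto intro!: Greatest_equality)

lemma (in group_hom) hom_finprod:
  assumes "comm_group G" "comm_group H" "finite S" "g \<in> S \<rightarrow> carrier G"
  shows "h (finprod G g S) = finprod H (\<lambda>x. h (g x)) S"
  using assms(3,4)
proof (induction S rule: finite_induct)
  case empty
  interpret G': comm_group G by fact
  interpret H': comm_group H by fact
  show ?case by simp
next
  case (insert x S)
  interpret G': comm_group G by fact
  interpret H': comm_group H by fact
  have "(\<lambda>x. h (g x)) \<in> S \<rightarrow> carrier H"
  proof
    fix y assume "y \<in> S" 
    then have "g y \<in> carrier G" using insert.prems by blast
    then show "h (g y) \<in> carrier H" by simp
  qed
  moreover have "g \<in> S \<rightarrow> carrier G" "g x \<in> carrier G" using insert by auto
  ultimately show ?case using insert by (simp add: G'.finprod_insert H'.finprod_insert)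
qed

context comm_group
begin

lemma Z_independent_one_notin: "Z_independent G S \<Longrightarrow> \<one> \<notin> S"
proof
  assume S: "Z_independent G S" "\<one> \<in> S"
  have "finprod G (\<lambda>x. x [^] (if x = \<one> then 1 else 0 :: int)) S = \<one>"
    by (rule finprod_one_eqI) auto
  with Z_independentD[OF S(1) this S(2)] show False by simp
qed

lemma rk_subset_one: assumes "K \<subseteq> {\<one>}" shows "fin_rk G K" "rk G K = 0"
proof -
  have "card S \<le> 0" if "S \<subseteq> K" "Z_independent G S" for S
    using Z_independent_one_notin[OF that(2)] that(1) assms by (metis card.empty le_refl subset_singletonD subset_empty insertI1)
  moreover have "\<exists>S\<subseteq>K. Z_independent G S \<and> card S = 0" using Z_independent_empty by fastforce
  ultimately show "fin_rk G K" "rk G K = 0" using rk_eqI[of K G 0] by auto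
qed

lemma finprod_int_pow:
  fixes m :: int
  assumes "finite S" "f \<in> S \<rightarrow> carrier G"
  shows "finprod G f S [^] m = finprod G (\<lambda>x. f x [^] m) S"
  using assms
proof (induction S rule: finite_induct)
  case (insert x S)
  then show ?case by (auto simp: Pi_iff int_pow_distrib)
qed simp

lemma int_pow_sum:
  fixes n :: "'i \<Rightarrow> int"
  assumes "finite S" "x \<in> carrier G"
  shows "x [^] (\<Sum>i\<in>S. n i) = finprod G (\<lambda>i. x [^] n i) S"
  using assms(1)
proof (induction S rule: finite_induct)
  case (insert i S)
  then show ?case using assms(2) by (simp add: Pi_iff int_pow_mult)
qed simp

lemma finprod_swap:
  assumes "finite S" "finite E" "\<And>x e. x \<in> S \<Longrightarrow> e \<in> E \<Longrightarrow> f x e \<in> carrier G"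
  shows "finprod G (\<lambda>x. finprod G (f x) E) S = finprod G (\<lambda>e. finprod G (\<lambda>x. f x e) S) E"
  using assms(1,3)
proof (induction S rule: finite_induct)
  case (insert x S)
  have "finprod G (\<lambda>x. finprod G (f x) E) (insert x S) =
      finprod G (f x) E \<otimes> finprod G (\<lambda>e. finprod G (\<lambda>x. f x e) S) E"
    using insert by (subst finprod_insert) (auto simp: Pi_iff intro!: finprod_closed)
  also have "\<dots> = finprod G (\<lambda>e. f x e \<otimes> finprod G (\<lambda>x. f x e) S) E"
    using insert by (subst finprod_multf) (auto simp: Pi_iff intro!: finprod_closed)
  also have "\<dots> = finprod G (\<lambda>e. finprod G (\<lambda>x. f x e) (insert x S)) E"
    using insert by (intro finprod_cong) (auto simp: Pi_iff simp_implies_def intro!: finprod_closed finprod_insert[symmetric])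
  finally show ?case .
qed simp

text \<open>The Steinitz bound over the integers. Spanning is asked only up to a non-zero multiple
  \<open>L\<close>, as over the rationals. If \<open>S\<close> were larger than \<open>E\<close>,
  the coefficients \<open>c\<close> would have an integer kernel vector \<open>z\<close>, and
  \<open>L x * z x\<close> would be a non-trivial relation on \<open>S\<close>.\<close>

lemma Z_independent_card_le:
  assumes "Z_independent G S" "finite E" "E \<subseteq> carrier G"
    and span: "\<And>x. x \<in> S \<Longrightarrow> \<exists>L c. (L::int) \<noteq> 0 \<and> x [^] L = finprod G (\<lambda>e. e [^] (c e :: int)) E"
  shows "card S \<le> card E"
proof (rule ccontr)
  assume "\<not> ?thesis"
  then have lt: "card E < card S" by simp
  have S: "finite S" "S \<subseteq> carrier G" using assms(1) by (auto simp: Z_independent_def)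
  from span obtain L c where L: "\<And>x. x \<in> S \<Longrightarrow> (L x::int) \<noteq> 0"
    and c: "\<And>x. x \<in> S \<Longrightarrow> x [^] L x = finprod G (\<lambda>e. e [^] (c x e :: int)) E" by metis
  obtain z where z: "\<exists>x\<in>S. z x \<noteq> 0" "\<And>e. e\<in>E \<Longrightarrow> (\<Sum>x\<in>S. z x * c x e) = 0"
    using integer_homogeneous_system[OF assms(2) S(1) lt, of c] by blast
  have "finprod G (\<lambda>x. x [^] (L x * z x)) S = finprod G (\<lambda>x. finprod G (\<lambda>e. e [^] (z x * c x e)) E) S"
  proof (rule finprod_cong'[OF refl])
    fix x assume "x \<in> S" 
    then have "x \<in> carrier G" using S by auto
    have "x [^] (L x * z x) = (x [^] L x) [^] z x" using \<open>x \<in> carrier G\<close> by (simp add: int_pow_pow)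
    also have "\<dots> = finprod G (\<lambda>e. (e [^] c x e) [^] z x) E" unfolding c[OF \<open>x \<in> S\<close>]
      using assms(2,3) by (intro finprod_int_pow) auto
    also have "\<dots> = finprod G (\<lambda>e. e [^] (z x * c x e)) E"
      using assms(3) by (intro finprod_cong) (auto simp: int_pow_pow mult.commute simp_implies_def)
    finally show "x [^] (L x * z x) = \<dots>" .
  qed (use assms(3) in \<open>auto simp: Pi_iff intro!: finprod_closed\<close>)
  also have "\<dots> = finprod G (\<lambda>e. finprod G (\<lambda>x. e [^] (z x * c x e)) S) E"
    using S assms(2,3) by (intro finprod_swap) auto
  also have "\<dots> = \<one>"
  proof (rule finprod_one_eqI)
    fix e assume e: "e \<in> E"
    then have "e \<in> carrier G" using assms by auto
    then show "finprod G (\<lambda>x. e [^] (z x * c x e)) S = \<one>"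
      using int_pow_sum[OF S(1), of e "\<lambda>x. z x * c x e"] z(2)[OF e] by simp
  qed
  finally have "\<forall>x\<in>S. L x * z x = 0"
    using Z_independentD[OF assms(1), of "\<lambda>x. L x * z x"] by simp
  with L z(1) show False by auto
qed

text \<open>Adding a new \<open>x\<close> to a maximal independent set creates a relation, in which
  independence of \<open>S\<close> forces the coefficient of \<open>x\<close> to be
  non-zero.\<close>

lemma maximal_independent_span:
  assumes "fin_rk G K" "S \<subseteq> K" "Z_independent G S" "card S = rk G K" "x \<in> K" "K \<subseteq> carrier G"
  shows "\<exists>L c. (L::int) \<noteq> 0 \<and> x [^] L = finprod G (\<lambda>e. e [^] (c e :: int)) S"
proof (cases "x \<in> S")
  case True
  have fS: "finite S" "S \<subseteq> carrier G" using assms by (auto simp: Z_independent_def)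
  have "x = finprod G (\<lambda>e. if x = e then e else \<one>) S"
    using finprod_singleton[OF True fS(1), of "\<lambda>x. x"] fS by (simp add: Pi_def subset_iff)
  also have "\<dots> = finprod G (\<lambda>e. e [^] (if x = e then 1 else 0 :: int)) S"
    using fS by (intro finprod_cong) (auto simp: int_pow_1 simp_implies_def)
  finally have "x [^] (1::int) = finprod G (\<lambda>e. e [^] (if x = e then 1 else 0 :: int)) S"
    using True fS by (simp add: int_pow_1 subset_iff)
  then show ?thesis by (intro exI[of _ "1::int"] exI conjI) (simp, assumption)
next
  case False
  have fS: "finite S" "S \<subseteq> carrier G" using assms by (auto simp: Z_independent_def)
  have x: "x \<in> carrier G" using assms by auto
  have "\<not> Z_independent G (insert x S)"
    using rk_le[OF assms(1), of "insert x S"] assms False fS by auto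
  then obtain n where n: "finprod G (\<lambda>x. x [^] (n x :: int)) (insert x S) = \<one>" "\<exists>y\<in>insert x S. n y \<noteq> 0"
    using fS x unfolding Z_independent_def by auto
  have eq: "x [^] n x \<otimes> finprod G (\<lambda>x. x [^] n x) S = \<one>"
    using n(1) False fS x by (subst (asm) finprod_insert) auto
  have "n x \<noteq> 0"
  proof
    assume "n x = 0"
    with eq x fS have "finprod G (\<lambda>x. x [^] n x) S = \<one>" by (simp add: Pi_iff subset_iff finprod_closed)
    then have "\<forall>x\<in>S. n x = 0" using assms(3) by (auto simp: Z_independent_def)
    with n(2) \<open>n x = 0\<close> show False by auto
  qed
  moreover have "x [^] (- n x) = finprod G (\<lambda>x. x [^] n x) S"
  proof -
    have "finprod G (\<lambda>x. x [^] n x) S \<in> carrier G" using fS by (intro finprod_closed) auto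
    then show ?thesis using eq x by (metis int_pow_closed int_pow_neg inv_equality m_comm)
  qed
  ultimately show ?thesis by (metis neg_equal_0_iff_equal)
qed

end

text \<open>Applying \<open>f\<close> to a relation removes \<open>S1\<close> and leaves a relation
  on \<open>S2\<close>; once those coefficients vanish, what remains is a relation on
  \<open>S1\<close>.\<close>

lemma Z_independent_lift:
  assumes "comm_group G" "comm_group H" "f \<in> hom G H"
    and S1: "S1 \<subseteq> kernel G H f" "Z_independent G S1"
    and S2: "S2 \<subseteq> f ` carrier G" "Z_independent H S2"
    and s: "\<And>y. y \<in> S2 \<Longrightarrow> s y \<in> carrier G \<and> f (s y) = y"
  shows "Z_independent G (S1 \<union> s ` S2)" "card (S1 \<union> s ` S2) = card S1 + card S2"
proof -
  interpret G: comm_group G by fact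
  interpret H: comm_group H by fact
  interpret f: group_hom G H f using assms(3) by unfold_locales
  have fin: "finite S1" "finite S2" "S1 \<subseteq> carrier G" "S2 \<subseteq> carrier H" using S1 S2 by (auto simp: Z_independent_def)
  have inj: "inj_on s S2" using s by (metis inj_onI)
  have one: "\<one>\<^bsub>H\<^esub> \<notin> S2" using H.Z_independent_one_notin[OF S2(2)] .
  have disj: "S1 \<inter> s ` S2 = {}" using s one S1(1) by (force simp: kernel_def)
  show "card (S1 \<union> s ` S2) = card S1 + card S2"
    using card_Un_disjoint[OF _ _ disj] fin card_image[OF inj] by simp
  have sub: "S1 \<union> s ` S2 \<subseteq> carrier G" using fin s by auto
  show "Z_independent G (S1 \<union> s ` S2)" unfolding Z_independent_def
  proof (intro conjI allI impI)
    fix n :: "_ \<Rightarrow> int"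
    assume 1: "finprod G (\<lambda>x. x [^]\<^bsub>G\<^esub> n x) (S1 \<union> s ` S2) = \<one>\<^bsub>G\<^esub>"
    have "\<one>\<^bsub>H\<^esub> = f (finprod G (\<lambda>x. x [^]\<^bsub>G\<^esub> n x) (S1 \<union> s ` S2))" unfolding 1 by simp
    also have "\<dots> = finprod H (\<lambda>x. f (x [^]\<^bsub>G\<^esub> n x)) (S1 \<union> s ` S2)"
      using fin sub assms by (intro f.hom_finprod) auto
    also have "\<dots> = finprod H (\<lambda>x. f (x [^]\<^bsub>G\<^esub> n x)) (s ` S2)"
    proof (rule H.finprod_mono_neutral_cong_right)
      fix i assume "i \<in> S1 \<union> s ` S2 - s ` S2"
      then have "i \<in> carrier G" "f i = \<one>\<^bsub>H\<^esub>" using S1(1) by (auto simp: kernel_def)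
      then show "f (i [^]\<^bsub>G\<^esub> n i) = \<one>\<^bsub>H\<^esub>" by (simp add: f.hom_int_pow)
    qed (use fin sub in auto)
    also have "\<dots> = finprod H (\<lambda>y. f (s y [^]\<^bsub>G\<^esub> n (s y))) S2"
      using inj s by (subst H.finprod_reindex) auto
    also have "\<dots> = finprod H (\<lambda>y. y [^]\<^bsub>H\<^esub> n (s y)) S2"
      using s fin by (intro H.finprod_cong) (auto simp: f.hom_int_pow simp_implies_def)
    finally have n2: "\<forall>y\<in>S2. n (s y) = 0"
      using Z_independentD[OF S2(2), of "\<lambda>y. n (s y)"] by simp
    have "finprod G (\<lambda>x. x [^]\<^bsub>G\<^esub> n x) (S1 \<union> s ` S2) = finprod G (\<lambda>x. x [^]\<^bsub>G\<^esub> n x) S1"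
      using fin sub n2 by (intro G.finprod_mono_neutral_cong_right) auto
    with 1 have "\<forall>x\<in>S1. n x = 0" using S1(2) by (simp add: Z_independent_def)
    with n2 show "\<forall>x\<in>S1 \<union> s ` S2. n x = 0" by auto
  qed (use fin s in auto)
qed

text \<open>Finiteness is stated as an equivalence so that, along an exact sequence, it passes from
  two of the three families of groups to the third. A maximal independent set for the whole group
  consists of one for the kernel and lifts of one for the image.\<close>

theorem rank_nullity:
  assumes "comm_group G" "comm_group H" "f \<in> hom G H"
  shows "fin_rk G (carrier G) \<longleftrightarrow> fin_rk G (kernel G H f) \<and> fin_rk H (f ` carrier G)"
    and "fin_rk G (carrier G) \<Longrightarrow> rk G (carrier G) = rk G (kernel G H f) + rk H (f ` carrier G)"
proof -
  interpret G: comm_group G by fact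
  interpret H: comm_group H by fact
  interpret f: group_hom G H f using assms(3) by unfold_locales
  define s where "s y = (SOME x. x \<in> carrier G \<and> f x = y)" for y
  have s: "s y \<in> carrier G \<and> f (s y) = y" if "y \<in> f ` carrier G" for y
    unfolding s_def by (rule someI_ex) (use that in auto)
  have kerG: "kernel G H f \<subseteq> carrier G" by (auto simp: kernel_def)
  have fin1: "fin_rk G (kernel G H f) \<and> fin_rk H (f ` carrier G)" if G: "fin_rk G (carrier G)"
  proof
    show "fin_rk G (kernel G H f)" using fin_rk_mono[OF G kerG] .
    show "fin_rk H (f ` carrier G)" unfolding fin_rk_def
    proof (intro exI allI impI)
      fix S assume S: "S \<subseteq> f ` carrier G" "Z_independent H S"
      have *: "\<And>y. y \<in> S \<Longrightarrow> s y \<in> carrier G \<and> f (s y) = y" using s S by auto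
      have "Z_independent G ({} \<union> s ` S)" "card ({} \<union> s ` S) = card {} + card S"
        using Z_independent_lift[OF assms _ Z_independent_empty S *] by auto
      then have "Z_independent G (s ` S)" "card (s ` S) = card S" by simp_all
      moreover have "s ` S \<subseteq> carrier G" using * by auto
      ultimately show "card S \<le> rk G (carrier G)" using rk_le[OF G] by metis
    qed
  qed
  have main: "fin_rk G (carrier G) \<and> rk G (carrier G) = rk G (kernel G H f) + rk H (f ` carrier G)"
    if fk: "fin_rk G (kernel G H f)" and fi: "fin_rk H (f ` carrier G)"
  proof -
    obtain S1 where S1: "S1 \<subseteq> kernel G H f" "Z_independent G S1" "card S1 = rk G (kernel G H f)"
      using rk_attained[OF fk] by blast
    obtain S2 where S2: "S2 \<subseteq> f ` carrier G" "Z_independent H S2" "card S2 = rk H (f ` carrier G)"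
      using rk_attained[OF fi] by blast
    have sS2: "\<And>y. y \<in> S2 \<Longrightarrow> s y \<in> carrier G \<and> f (s y) = y" using s S2 by auto
    define E where "E = S1 \<union> s ` S2"
    have E: "Z_independent G E" "card E = rk G (kernel G H f) + rk H (f ` carrier G)"
      using Z_independent_lift[OF assms S1(1,2) S2(1,2) sS2] S1 S2 by (auto simp: E_def)
    have fin: "finite S1" "finite S2" "S1 \<subseteq> carrier G" "S2 \<subseteq> carrier H" using S1 S2 by (auto simp: Z_independent_def)
    have inj: "inj_on s S2" using sS2 by (metis inj_onI)
    have disj: "S1 \<inter> s ` S2 = {}" using sS2 S1(1) H.Z_independent_one_notin[OF S2(2)] by (force simp: kernel_def)
    have Ecar: "finite E" "E \<subseteq> carrier G" using E(1) by (auto simp: Z_independent_def)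
    have span: "\<exists>L c. (L::int) \<noteq> 0 \<and> x [^]\<^bsub>G\<^esub> L = finprod G (\<lambda>e. e [^]\<^bsub>G\<^esub> (c e :: int)) E"
      if x: "x \<in> carrier G" for x
    proof -
      have "\<exists>L c. (L::int) \<noteq> 0 \<and> f x [^]\<^bsub>H\<^esub> L = finprod H (\<lambda>e. e [^]\<^bsub>H\<^esub> (c e :: int)) S2"
        by (rule H.maximal_independent_span[OF fi S2]) (use x in auto)
      then obtain N m where N: "(N::int) \<noteq> 0" "f x [^]\<^bsub>H\<^esub> N = finprod H (\<lambda>e. e [^]\<^bsub>H\<^esub> (m e :: int)) S2"
        by auto
      define w where "w = finprod G (\<lambda>y. s y [^]\<^bsub>G\<^esub> m y) S2"
      have w: "w \<in> carrier G" unfolding w_def using sS2 by (intro G.finprod_closed) auto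
      have "f w = finprod H (\<lambda>y. f (s y [^]\<^bsub>G\<^esub> m y)) S2"
        unfolding w_def using fin sS2 assms by (intro f.hom_finprod) auto
      also have "\<dots> = finprod H (\<lambda>y. y [^]\<^bsub>H\<^esub> m y) S2"
        using sS2 fin by (intro H.finprod_cong) (auto simp: f.hom_int_pow simp_implies_def)
      finally have fw: "f w = f x [^]\<^bsub>H\<^esub> N" using N by simp
      \<comment> \<open>A multiple of \<open>x\<close> differs from the lifted combination
        \<open>w\<close> by an element of the kernel, where \<open>S1\<close> spans up to a further
        multiple \<open>M\<close>. Hence \<open>N * M\<close> is the multiple that works for
        \<open>x\<close>.\<close>
      define d where "d = x [^]\<^bsub>G\<^esub> N \<otimes>\<^bsub>G\<^esub> inv\<^bsub>G\<^esub> w"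
      have d: "d \<in> kernel G H f" unfolding d_def kernel_def using x w fw by (simp add: f.hom_int_pow)
      obtain M k where M: "(M::int) \<noteq> 0" "d [^]\<^bsub>G\<^esub> M = finprod G (\<lambda>e. e [^]\<^bsub>G\<^esub> (k e :: int)) S1"
        using G.maximal_independent_span[OF fk S1 d kerG] by auto
      define c where "c e = (if e \<in> S1 then k e else m (f e) * M)" for e
      have xN: "x [^]\<^bsub>G\<^esub> N = d \<otimes>\<^bsub>G\<^esub> w" unfolding d_def using x w by (simp add: G.m_assoc)
      have "x [^]\<^bsub>G\<^esub> (N * M) = (d \<otimes>\<^bsub>G\<^esub> w) [^]\<^bsub>G\<^esub> M" using x by (simp add: xN[symmetric] G.int_pow_pow)
      also have "\<dots> = d [^]\<^bsub>G\<^esub> M \<otimes>\<^bsub>G\<^esub> w [^]\<^bsub>G\<^esub> M" using w d kerG by (auto simp: G.int_pow_distrib)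
      also have "w [^]\<^bsub>G\<^esub> M = finprod G (\<lambda>y. (s y [^]\<^bsub>G\<^esub> m y) [^]\<^bsub>G\<^esub> M) S2"
        unfolding w_def using fin sS2 by (intro G.finprod_int_pow) auto
      also have "\<dots> = finprod G (\<lambda>y. s y [^]\<^bsub>G\<^esub> c (s y)) S2"
        using sS2 disj by (intro G.finprod_cong) (auto simp: G.int_pow_pow c_def simp_implies_def)
      also have "\<dots> = finprod G (\<lambda>e. e [^]\<^bsub>G\<^esub> c e) (s ` S2)"
        using inj sS2 by (subst G.finprod_reindex) auto
      also have "d [^]\<^bsub>G\<^esub> M = finprod G (\<lambda>e. e [^]\<^bsub>G\<^esub> c e) S1"
        unfolding M(2) using fin by (intro G.finprod_cong) (auto simp: c_def simp_implies_def)
      finally have "x [^]\<^bsub>G\<^esub> (N * M) = finprod G (\<lambda>e. e [^]\<^bsub>G\<^esub> c e) E"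
        unfolding E_def using fin sS2 disj by (subst G.finprod_Un_disjoint) auto
      then show ?thesis using N(1) M(1) by (metis mult_eq_0_iff)
    qed
    have "card S \<le> card E" if "S \<subseteq> carrier G" "Z_independent G S" for S
    proof (rule G.Z_independent_card_le[OF that(2) Ecar])
      show "\<exists>L c. (L::int) \<noteq> 0 \<and> x [^]\<^bsub>G\<^esub> L = finprod G (\<lambda>e. e [^]\<^bsub>G\<^esub> (c e :: int)) E" if "x \<in> S" for x
        using span \<open>S \<subseteq> carrier G\<close> that by (meson subsetD)
    qed
    then show ?thesis using rk_eqI[of "carrier G" G "card E"] E Ecar by auto
  qed
  show "fin_rk G (carrier G) \<longleftrightarrow> fin_rk G (kernel G H f) \<and> fin_rk H (f ` carrier G)"
    "fin_rk G (carrier G) \<Longrightarrow> rk G (carrier G) = rk G (kernel G H f) + rk H (f ` carrier G)"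
    using fin1 main by blast+
qed

lemma rk_iso:
  assumes "comm_group G" "comm_group H" "G \<cong> H" "fin_rk G (carrier G)"
  shows "fin_rk H (carrier H)" "rk H (carrier H) = rk G (carrier G)"
proof -
  interpret G: comm_group G by fact
  obtain f where f: "f \<in> hom G H" "bij_betw f (carrier G) (carrier H)"
    using assms(3) by (auto simp: is_iso_def iso_def)
  interpret f: group_hom G H f using f assms comm_group_def by (simp add: group_hom_def group_hom_axioms_def comm_group_def)
  have ker: "kernel G H f \<subseteq> {\<one>\<^bsub>G\<^esub>}" using f(2) by (auto simp: kernel_def bij_betw_def dest: inj_onD[of _ _ _ "\<one>\<^bsub>G\<^esub>"])
  have im: "f ` carrier G = carrier H" using f(2) by (simp add: bij_betw_def)
  show "fin_rk H (carrier H)" "rk H (carrier H) = rk G (carrier G)"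
    using rank_nullity[OF assms(1,2) f(1)] G.rk_subset_one[OF ker] assms(4) im by auto
qed

lemma rk_integer_group: "fin_rk integer_group (carrier integer_group)" "rk integer_group (carrier integer_group) = 1"
proof -
  interpret Z: comm_group integer_group by (rule abelian_integer_group)
  have pw: "x [^]\<^bsub>integer_group\<^esub> (n::int) = n * x" for x n by simp
  have 1: "Z_independent integer_group {1}" unfolding Z_independent_def
    by (auto simp: pw Z.finprod_insert)
  have "card S \<le> card {1::int}" if "Z_independent integer_group S" for S
  proof (rule Z.Z_independent_card_le[OF that])
    fix x :: int
    show "\<exists>L c. (L::int) \<noteq> 0 \<and> x [^]\<^bsub>integer_group\<^esub> L = finprod integer_group (\<lambda>e. e [^]\<^bsub>integer_group\<^esub> (c e :: int)) {1}"
      by (rule exI[of _ 1], rule exI[of _ "\<lambda>_. x"]) (simp add: pw Z.finprod_insert)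
  qed auto
  then have le: "\<And>S. S \<subseteq> carrier integer_group \<Longrightarrow> Z_independent integer_group S \<Longrightarrow> card S \<le> 1" by simp
  have ex: "\<exists>S\<subseteq>carrier integer_group. Z_independent integer_group S \<and> card S = 1"
    using 1 by (intro exI[of _ "{1}"]) simp
  show "fin_rk integer_group (carrier integer_group)" "rk integer_group (carrier integer_group) = 1"
    using rk_eqI[OF le ex] by simp_all
qed


section \<open>Euler characteristics of pairs\<close>

text \<open>A relation rather than a function: vanishing in high degrees belongs to the claim, and
  every long enough partial sum then computes \<open>e\<close>.\<close>

definition alt_sum :: "(nat \<Rightarrow> nat) \<Rightarrow> int \<Rightarrow> bool" where
  "alt_sum a e \<longleftrightarrow> (\<exists>N. (\<forall>p\<ge>N. a p = 0) \<and> e = (\<Sum>p<N. (- 1) ^ p * int (a p)))"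

lemma alt_sum_eventually:
  assumes "alt_sum a e"
  shows "\<exists>N. \<forall>M\<ge>N. (\<forall>p\<ge>M. a p = 0) \<and> e = (\<Sum>p<M. (- 1) ^ p * int (a p))"
proof -
  obtain N where N: "\<forall>p\<ge>N. a p = 0" "e = (\<Sum>p<N. (- 1) ^ p * int (a p))"
    using assms unfolding alt_sum_def by blast
  have "(\<Sum>p<M. (- 1) ^ p * int (a p)) = (\<Sum>p<N. (- 1) ^ p * int (a p))" if "M \<ge> N" for M
  proof (rule sum.mono_neutral_right)
    show "\<forall>i\<in>{..<M} - {..<N}. (- 1) ^ i * int (a i) = 0" using N(1) by auto
  qed (use that in auto)
  then show ?thesis using N by (metis order_trans)
qed

lemma alt_sum_eq_sum:
  assumes "alt_sum a e" shows "e = (\<Sum>p | a p \<noteq> 0. (- 1) ^ p * int (a p))"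
proof -
  obtain N where N: "\<forall>p\<ge>N. a p = 0" "e = (\<Sum>p<N. (- 1) ^ p * int (a p))"
    using assms unfolding alt_sum_def by blast
  have "{p. a p \<noteq> 0} \<subseteq> {..<N}" using N(1) by (metis (mono_tags) lessThan_iff mem_Collect_eq not_le subsetI)
  then show ?thesis unfolding N(2)
    by (intro sum.mono_neutral_right[where T = "{..<N}" and S = "{p. a p \<noteq> 0}"]) auto
qed

text \<open>
  \<open>\<alpha>\<close>, \<open>\<beta>\<close>, \<open>\<gamma>\<close> stand for the ranks of the images of the three maps of a long exact sequence.
\<close>

lemma alt_sum_exact:
  assumes a: "\<And>p. a p = \<alpha> p + \<gamma> (Suc p)" and x: "\<And>p. x p = \<alpha> p + \<beta> p"
    and r: "\<And>p. r p = \<beta> p + \<gamma> p" and "\<gamma> 0 = 0"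
  shows "alt_sum a e1 \<Longrightarrow> alt_sum x e2 \<Longrightarrow> alt_sum r (e2 - e1)"
    and "alt_sum x e2 \<Longrightarrow> alt_sum r e3 \<Longrightarrow> alt_sum a (e2 - e3)"
    and "alt_sum a e1 \<Longrightarrow> alt_sum r e3 \<Longrightarrow> alt_sum x (e1 + e3)"
proof -
  \<comment> \<open>Each \<open>\<gamma> p\<close> occurs in two consecutive degrees with opposite
    signs, so only the two end terms survive.\<close>
  have tel: "(\<Sum>p<n. (- 1) ^ p * int (x p)) + \<gamma> 0 - (- 1) ^ n * int (\<gamma> n) =
      (\<Sum>p<n. (- 1) ^ p * int (a p)) + (\<Sum>p<n. (- 1) ^ p * int (r p))" for n
    by (induction n) (auto simp: a x r algebra_simps)
  have sum: "(\<Sum>p<n. (- 1) ^ p * int (x p)) =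
      (\<Sum>p<n. (- 1) ^ p * int (a p)) + (\<Sum>p<n. (- 1) ^ p * int (r p))" if "\<gamma> n = 0" for n
    using tel[of n] that \<open>\<gamma> 0 = 0\<close> by simp
  show "alt_sum r (e2 - e1)" if h: "alt_sum a e1" "alt_sum x e2"
  proof -
    obtain N1 where N1: "\<And>M. M\<ge>N1 \<Longrightarrow> (\<forall>p\<ge>M. a p = 0) \<and> e1 = (\<Sum>p<M. (- 1) ^ p * int (a p))"
      using alt_sum_eventually[OF h(1)] by blast
    obtain N2 where N2: "\<And>M. M\<ge>N2 \<Longrightarrow> (\<forall>p\<ge>M. x p = 0) \<and> e2 = (\<Sum>p<M. (- 1) ^ p * int (x p))"
      using alt_sum_eventually[OF h(2)] by blast
    \<comment> \<open>The successor is needed because vanishing of \<open>a q\<close> yields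
      vanishing of \<open>\<gamma>\<close> only at \<open>Suc q\<close>.\<close>
    define N where "N = Suc (max N1 N2)"
    have g: "\<gamma> p = 0" if p: "p \<ge> N" for p
    proof -
      obtain q where q: "p = Suc q" "q \<ge> N1" using p by (cases p) (auto simp: N_def)
      then show ?thesis using N1[of N1] a[of q] by auto
    qed
    have b: "\<beta> p = 0" if "p \<ge> N" for p using N2[of N2] x[of p] that by (auto simp: N_def)
    have "e1 = (\<Sum>p<N. (- 1) ^ p * int (a p))" "e2 = (\<Sum>p<N. (- 1) ^ p * int (x p))"
      using N1[of N] N2[of N] by (auto simp: N_def)
    then have "e2 - e1 = (\<Sum>p<N. (- 1) ^ p * int (r p))" using sum[OF g[of N]] by simp
    then show ?thesis unfolding alt_sum_def using g b r by (intro exI[of _ N]) auto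
  qed
  show "alt_sum a (e2 - e3)" if h: "alt_sum x e2" "alt_sum r e3"
  proof -
    obtain N1 where N1: "\<And>M. M\<ge>N1 \<Longrightarrow> (\<forall>p\<ge>M. x p = 0) \<and> e2 = (\<Sum>p<M. (- 1) ^ p * int (x p))"
      using alt_sum_eventually[OF h(1)] by blast
    obtain N2 where N2: "\<And>M. M\<ge>N2 \<Longrightarrow> (\<forall>p\<ge>M. r p = 0) \<and> e3 = (\<Sum>p<M. (- 1) ^ p * int (r p))"
      using alt_sum_eventually[OF h(2)] by blast
    define N where "N = max N1 N2"
    have g: "\<gamma> p = 0" if "p \<ge> N" for p using N2[of N2] r[of p] that by (auto simp: N_def)
    have al: "\<alpha> p = 0" if "p \<ge> N" for p using N1[of N1] x[of p] that by (auto simp: N_def)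
    have "e2 = (\<Sum>p<N. (- 1) ^ p * int (x p))" "e3 = (\<Sum>p<N. (- 1) ^ p * int (r p))"
      using N1[of N] N2[of N] by (auto simp: N_def)
    then have "e2 - e3 = (\<Sum>p<N. (- 1) ^ p * int (a p))" using sum[OF g[of N]] by simp
    then show ?thesis unfolding alt_sum_def using g al a by (intro exI[of _ N]) auto
  qed
  show "alt_sum x (e1 + e3)" if h: "alt_sum a e1" "alt_sum r e3"
  proof -
    obtain N1 where N1: "\<And>M. M\<ge>N1 \<Longrightarrow> (\<forall>p\<ge>M. a p = 0) \<and> e1 = (\<Sum>p<M. (- 1) ^ p * int (a p))"
      using alt_sum_eventually[OF h(1)] by blast
    obtain N2 where N2: "\<And>M. M\<ge>N2 \<Longrightarrow> (\<forall>p\<ge>M. r p = 0) \<and> e3 = (\<Sum>p<M. (- 1) ^ p * int (r p))"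
      using alt_sum_eventually[OF h(2)] by blast
    define N where "N = max N1 N2"
    have g: "\<gamma> p = 0" "\<beta> p = 0" if "p \<ge> N" for p using N2[of N2] r[of p] that by (auto simp: N_def)
    have al: "\<alpha> p = 0" if "p \<ge> N" for p using N1[of N1] a[of p] that by (auto simp: N_def)
    have "e1 = (\<Sum>p<N. (- 1) ^ p * int (a p))" "e3 = (\<Sum>p<N. (- 1) ^ p * int (r p))"
      using N1[of N] N2[of N] by (auto simp: N_def)
    then have "e1 + e3 = (\<Sum>p<N. (- 1) ^ p * int (x p))" using sum[OF g(1)[of N]] by simp
    then show ?thesis unfolding alt_sum_def using g al x by (intro exI[of _ N]) auto
  qed
qed

text \<open>The value together with the finiteness that makes it additive. Degrees are natural
  numbers since homology vanishes in negative degrees.\<close>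

definition has_euler :: "'a topology \<Rightarrow> 'a set \<Rightarrow> int \<Rightarrow> bool" where
  "has_euler X S e \<longleftrightarrow>
     (\<forall>p::nat. fin_rk (relative_homology_group (int p) X S) (carrier (relative_homology_group (int p) X S))) \<and>
     alt_sum (\<lambda>p. rk (relative_homology_group (int p) X S) (carrier (relative_homology_group (int p) X S))) e"

lemma has_euler_imp_euler_char: "has_euler X {} e \<Longrightarrow> euler_char X = e"
  unfolding has_euler_def euler_char_def betti_def abelian_rank_eq_rk
  by (elim conjE) (rule alt_sum_eq_sum[symmetric])

lemma has_euler_iso:
  assumes "has_euler X S e"
    "\<And>p. relative_homology_group (int p) X S \<cong> relative_homology_group (int p) Y T"
  shows "has_euler Y T e"
  using assms rk_iso[OF abelian_relative_homology_group abelian_relative_homology_group assms(2)]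
  by (simp add: has_euler_def)

lemma has_euler_homotopy_equivalent:
  assumes "has_euler X {} e" "X homotopy_equivalent_space Y"
  shows "has_euler Y {} e"
  using has_euler_iso[OF assms(1)] homotopy_equivalent_space_imp_isomorphic_homology_groups[OF assms(2)] by auto

lemma trivial_group_rk:
  assumes "comm_group G" "trivial_group G"
  shows "fin_rk G (carrier G)" "rk G (carrier G) = 0"
  using comm_group.rk_subset_one[OF assms(1), of "carrier G"] assms(2) by (auto simp: trivial_group_def)

section \<open>The empty space and the point\<close>

lemma has_euler_empty: "topspace X = {} \<Longrightarrow> has_euler X {} 0"
  using trivial_group_rk[OF abelian_relative_homology_group trivial_homology_group_empty]
  by (auto simp: has_euler_def alt_sum_def intro!: exI[of _ 0])

lemma has_euler_singleton:
  assumes "topspace X = {a}" shows "has_euler X {} 1"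
proof -
  have 0: "fin_rk (homology_group 0 X) (carrier (homology_group 0 X))" "rk (homology_group 0 X) (carrier (homology_group 0 X)) = 1"
    using rk_iso[OF abelian_integer_group abelian_relative_homology_group _ rk_integer_group(1), of 0 X "{}"]
      group.iso_sym[OF _ homology_coefficients[OF assms]] rk_integer_group(2) by auto
  have 1: "fin_rk (homology_group (int p) X) (carrier (homology_group (int p) X))"
    "rk (homology_group (int p) X) (carrier (homology_group (int p) X)) = 0" if "p \<noteq> 0" for p
    using trivial_group_rk[OF abelian_relative_homology_group homology_dimension_axiom[OF assms]] that by auto
  have "fin_rk (homology_group (int p) X) (carrier (homology_group (int p) X))" for p
    using 0 1[of p] by (cases "p = 0") auto
  moreover have "alt_sum (\<lambda>p. rk (homology_group (int p) X) (carrier (homology_group (int p) X))) 1"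
    unfolding alt_sum_def using 0 1 by (intro exI[of _ 1]) auto
  ultimately show ?thesis by (simp add: has_euler_def)
qed

text \<open>The long exact sequence of the pair, cut at each of its maps by rank-nullity.\<close>

lemma has_euler_pair:
  shows "has_euler (subtopology X S) {} e1 \<Longrightarrow> has_euler X {} e2 \<Longrightarrow> has_euler X S (e2 - e1)"
    and "has_euler X {} e2 \<Longrightarrow> has_euler X S e3 \<Longrightarrow> has_euler (subtopology X S) {} (e2 - e3)"
    and "has_euler (subtopology X S) {} e1 \<Longrightarrow> has_euler X S e3 \<Longrightarrow> has_euler X {} (e1 + e3)"
proof -
  define A where "A p = homology_group (int p) (subtopology X S)" for p
  define B where "B p = homology_group (int p) X" for p
  define C where "C p = relative_homology_group (int p) X S" for p
  define i where "i p = hom_induced (int p) (subtopology X S) {} X {} id" for p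
  define j where "j p = hom_induced (int p) X {} X S id" for p
  define d where "d p = hom_boundary (int p) X S" for p
  have cg: "comm_group (A p)" "comm_group (B p)" "comm_group (C p)" for p
    by (auto simp: A_def B_def C_def)
  have i: "i p \<in> hom (A p) (B p)" for p
    unfolding i_def A_def B_def by (rule hom_induced_hom)
  have j: "j p \<in> hom (B p) (C p)" for p
    unfolding j_def C_def B_def by (rule hom_induced_hom)
  have d: "d p \<in> hom (C p) (homology_group (int p - 1) (subtopology X S))" for p
    unfolding d_def C_def by (rule hom_boundary_hom)
  have ker_j: "kernel (B p) (C p) (j p) = i p ` carrier (A p)" for p
    using homology_exactness_axiom_3[of "int p" X S] unfolding i_def j_def A_def B_def C_def by simp
  have ker_d: "kernel (C p) (homology_group (int p - 1) (subtopology X S)) (d p) = j p ` carrier (B p)" for p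
    using homology_exactness_axiom_1[of "int p" X S] unfolding d_def j_def B_def C_def by simp
  have ker_i: "kernel (A p) (B p) (i p) = d (Suc p) ` carrier (C (Suc p))" for p
    using homology_exactness_axiom_2[of "int (Suc p)" X S] unfolding d_def i_def A_def B_def C_def by simp
  define \<alpha> where "\<alpha> p = rk (B p) (i p ` carrier (A p))" for p
  define \<beta> where "\<beta> p = rk (C p) (j p ` carrier (B p))" for p
  define \<gamma> where "\<gamma> p = rk (homology_group (int p - 1) (subtopology X S)) (d p ` carrier (C p))" for p
  define f\<alpha> where "f\<alpha> p = fin_rk (B p) (i p ` carrier (A p))" for p
  define f\<beta> where "f\<beta> p = fin_rk (C p) (j p ` carrier (B p))" for p
  define f\<gamma> where "f\<gamma> p = fin_rk (homology_group (int p - 1) (subtopology X S)) (d p ` carrier (C p))" for p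
  have rA: "fin_rk (A p) (carrier (A p)) \<longleftrightarrow> f\<gamma> (Suc p) \<and> f\<alpha> p"
    "fin_rk (A p) (carrier (A p)) \<Longrightarrow> rk (A p) (carrier (A p)) = \<alpha> p + \<gamma> (Suc p)" for p
    using rank_nullity[OF cg(1,2) i[of p]] ker_i[of p]
    by (auto simp: f\<gamma>_def f\<alpha>_def \<alpha>_def \<gamma>_def A_def)
  have rB: "fin_rk (B p) (carrier (B p)) \<longleftrightarrow> f\<alpha> p \<and> f\<beta> p"
    "fin_rk (B p) (carrier (B p)) \<Longrightarrow> rk (B p) (carrier (B p)) = \<alpha> p + \<beta> p" for p
    using rank_nullity[OF cg(2,3) j[of p]] ker_j[of p]
    by (auto simp: f\<beta>_def f\<alpha>_def \<alpha>_def \<beta>_def)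
  have rC: "fin_rk (C p) (carrier (C p)) \<longleftrightarrow> f\<beta> p \<and> f\<gamma> p"
    "fin_rk (C p) (carrier (C p)) \<Longrightarrow> rk (C p) (carrier (C p)) = \<beta> p + \<gamma> p" for p
    using rank_nullity[OF cg(3) abelian_relative_homology_group d[of p]] ker_d[of p]
    by (auto simp: f\<beta>_def f\<gamma>_def \<gamma>_def \<beta>_def)
  \<comment> \<open>The sequence ends at degree 0: the boundary map out of it lands in the trivial
    homology of degree -1. This supplies the end condition on \<open>\<gamma>\<close>.\<close>
  have "d 0 ` carrier (C 0) \<subseteq> {\<one>\<^bsub>homology_group (int 0 - 1) (subtopology X S)\<^esub>}"
    using hom_carrier[OF d[of 0]] trivial_homology_group[of "int 0 - 1" "subtopology X S"]
    by (auto simp: trivial_group_def)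
  from comm_group.rk_subset_one[OF abelian_relative_homology_group this]
  have g0: "\<gamma> 0 = 0" "f\<gamma> 0" by (auto simp: \<gamma>_def f\<gamma>_def)
  have fg: "(\<forall>p. f\<gamma> p) \<longleftrightarrow> (\<forall>p. f\<gamma> (Suc p))" using g0(2) by (metis not0_implies_Suc)
  \<comment> \<open>Rank-nullity splits a rank only if it is finite, whereas
    \<open>alt_sum_exact\<close> asks for unconditional equations. The default branch makes the
    splittings hold always, and under \<open>has_euler\<close> it is never taken.\<close>
  define rkA where "rkA p = (if \<forall>p. fin_rk (A p) (carrier (A p)) then rk (A p) (carrier (A p)) else \<alpha> p + \<gamma> (Suc p))" for p
  define rkB where "rkB p = (if \<forall>p. fin_rk (B p) (carrier (B p)) then rk (B p) (carrier (B p)) else \<alpha> p + \<beta> p)" for p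
  define rkC where "rkC p = (if \<forall>p. fin_rk (C p) (carrier (C p)) then rk (C p) (carrier (C p)) else \<beta> p + \<gamma> p)" for p
  have eq: "rkA p = \<alpha> p + \<gamma> (Suc p)" "rkB p = \<alpha> p + \<beta> p" "rkC p = \<beta> p + \<gamma> p" for p
    using rA rB rC by (auto simp: rkA_def rkB_def rkC_def)
  have eA: "has_euler (subtopology X S) {} e \<longleftrightarrow> (\<forall>p. fin_rk (A p) (carrier (A p))) \<and> alt_sum rkA e" for e
    unfolding has_euler_def A_def[symmetric] by (auto simp: rkA_def[abs_def])
  have eB: "has_euler X {} e \<longleftrightarrow> (\<forall>p. fin_rk (B p) (carrier (B p))) \<and> alt_sum rkB e" for e
    unfolding has_euler_def B_def[symmetric] by (auto simp: rkB_def[abs_def])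
  have eC: "has_euler X S e \<longleftrightarrow> (\<forall>p. fin_rk (C p) (carrier (C p))) \<and> alt_sum rkC e" for e
    unfolding has_euler_def C_def[symmetric] by (auto simp: rkC_def[abs_def])
  note alt = alt_sum_exact[of rkA \<alpha> \<gamma> rkB \<beta> rkC, OF eq g0(1)]
  show "has_euler (subtopology X S) {} e1 \<Longrightarrow> has_euler X {} e2 \<Longrightarrow> has_euler X S (e2 - e1)"
    "has_euler X {} e2 \<Longrightarrow> has_euler X S e3 \<Longrightarrow> has_euler (subtopology X S) {} (e2 - e3)"
    "has_euler (subtopology X S) {} e1 \<Longrightarrow> has_euler X S e3 \<Longrightarrow> has_euler X {} (e1 + e3)"
    unfolding eA eB eC rA(1) rB(1) rC(1) using alt fg by blast+
qed

section \<open>Excision and the Mayer-Vietoris formula\<close>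

lemma has_euler_excision:
  assumes UV: "openin X U" "openin X V" "U \<union> V = topspace X"
  shows "has_euler X V e \<longleftrightarrow> has_euler (subtopology X U) (U \<inter> V) e"
proof -
  have "U \<subseteq> topspace X" "V \<subseteq> topspace X" using UV openin_subset by auto
  \<comment> \<open>The set cut out of the pair \<open>(X, V)\<close> is the complement of
    \<open>U\<close>: it is closed and, by the covering, contained in the open set
    \<open>V\<close>.\<close>
  have "closedin X (topspace X - U)" using UV by auto
  then have "X closure_of (topspace X - U) \<subseteq> X interior_of V"
    using UV by (auto simp: interior_of_openin closure_of_closedin)
  then have "hom_induced p (subtopology X (topspace X - (topspace X - U))) (V - (topspace X - U)) (subtopology X (topspace X)) V id
    \<in> iso (relative_homology_group p (subtopology X (topspace X - (topspace X - U))) (V - (topspace X - U)))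
          (relative_homology_group p (subtopology X (topspace X)) V)" for p
    using \<open>V \<subseteq> topspace X\<close> by (intro homology_excision_axiom)
  moreover have "topspace X - (topspace X - U) = U" "V - (topspace X - U) = U \<inter> V"
    using \<open>U \<subseteq> topspace X\<close> \<open>V \<subseteq> topspace X\<close> by auto
  ultimately have iso: "relative_homology_group p (subtopology X U) (U \<inter> V) \<cong> relative_homology_group p X V" for p
    by (metis is_isoI subtopology_topspace)
  then show ?thesis
    using has_euler_iso[of "subtopology X U" "U \<inter> V" e X V] has_euler_iso[of X V e "subtopology X U" "U \<inter> V"]
      group.iso_sym[OF group_relative_homology_group iso] by blast
qed

text \<open>The pairs \<open>(X, V)\<close> and \<open>(U, U \<inter> V)\<close> have the same
  relative homology by excision, so the differences of the Euler characteristics within the two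
  pairs agree.\<close>

theorem has_euler_Mayer_Vietoris:
  assumes UV: "openin X U" "openin X V" "U \<union> V = topspace X"
    and U: "has_euler (subtopology X U) {} a" and V: "has_euler (subtopology X V) {} b"
  shows "has_euler (subtopology X (U \<inter> V)) {} c \<Longrightarrow> has_euler X {} (a + b - c)"
    and "has_euler X {} e \<Longrightarrow> has_euler (subtopology X (U \<inter> V)) {} (a + b - e)"
proof -
  have sub: "subtopology (subtopology X U) (U \<inter> V) = subtopology X (U \<inter> V)"
    by (simp add: subtopology_subtopology)
  show "has_euler X {} (a + b - c)" if c: "has_euler (subtopology X (U \<inter> V)) {} c"
  proof -
    have "has_euler (subtopology X U) (U \<inter> V) (a - c)"
      using has_euler_pair(1)[of "subtopology X U" "U \<inter> V" c a] c U by (simp add: sub)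
    then have "has_euler X V (a - c)" using has_euler_excision[OF UV] by blast
    then show ?thesis using has_euler_pair(3)[OF V] by (metis add.commute add_diff_eq)
  qed
  show "has_euler (subtopology X (U \<inter> V)) {} (a + b - e)" if e: "has_euler X {} e"
  proof -
    have "has_euler X V (e - b)" using has_euler_pair(1)[OF V e] .
    then have "has_euler (subtopology X U) (U \<inter> V) (e - b)" using has_euler_excision[OF UV] by blast
    from has_euler_pair(2)[OF U this] show ?thesis by (simp add: sub algebra_simps)
  qed
qed


section \<open>Quotients of cones of series\<close>

lemma openin_quotient_top:
  "openin (quotient_top X q) U \<longleftrightarrow> U \<subseteq> q ` topspace X \<and> openin X {x \<in> topspace X. q x \<in> U}"
proof -
  have "istopology (\<lambda>U. U \<subseteq> q ` topspace X \<and> openin X {x \<in> topspace X. q x \<in> U})"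
    unfolding istopology_def
  proof (intro conjI allI impI; (elim conjE)?)
    fix S T assume "openin X {x \<in> topspace X. q x \<in> S}" "openin X {x \<in> topspace X. q x \<in> T}"
    moreover have "{x \<in> topspace X. q x \<in> S \<inter> T} = {x \<in> topspace X. q x \<in> S} \<inter> {x \<in> topspace X. q x \<in> T}" by auto
    ultimately show "openin X {x \<in> topspace X. q x \<in> S \<inter> T}" by auto
  next
    fix \<K> assume K: "\<forall>U\<in>\<K>. U \<subseteq> q ` topspace X \<and> openin X {x \<in> topspace X. q x \<in> U}"
    have "{x \<in> topspace X. q x \<in> \<Union> \<K>} = (\<Union>U\<in>\<K>. {x \<in> topspace X. q x \<in> U})" by auto
    then show "openin X {x \<in> topspace X. q x \<in> \<Union> \<K>}" using K by auto
  qed auto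
  then show ?thesis unfolding quotient_top_def by (simp add: topology_inverse')
qed

lemma topspace_quotient_top [simp]: "topspace (quotient_top X q) = q ` topspace X"
proof -
  have "{x \<in> topspace X. q x \<in> q ` topspace X} = topspace X" by auto
  then have "openin (quotient_top X q) (q ` topspace X)" by (simp add: openin_quotient_top)
  then show ?thesis by (meson openin_quotient_top openin_subset openin_topspace subset_antisym)
qed

lemma quotient_map_quotient_top: "quotient_map X (quotient_top X q) q"
  by (auto simp: quotient_map_def openin_quotient_top)

text \<open>This is how the subspace topology on a set of classes is recognized as the quotient
  topology of a cone.\<close>

lemma quotient_map_unique:
  assumes "quotient_map X Y q" "quotient_map X Z q" shows "Y = Z"
  using assms unfolding topology_eq quotient_map_def by (metis openin_subset)

section \<open>Classes modulo a coordinate subspace\<close>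

lemma power_series_zero: "(\<lambda>_. 0) \<in> power_series P"
  by (simp add: power_series_def)

lemma power_series_lin: "h \<in> power_series P \<Longrightarrow> g \<in> power_series P \<Longrightarrow> (\<lambda>x. c * h x + g x) \<in> power_series P"
  unfolding power_series_def mem_Collect_eq by (metis add_0 mult_zero_right)

lemma power_series_mono: "Q \<subseteq> P \<Longrightarrow> power_series Q \<subseteq> power_series P"
  by (auto simp: power_series_def)

lemma power_series_empty: "power_series {} = {\<lambda>_. 0}"
  by (auto simp: power_series_def)

text \<open>Every denominator that occurs consists of all series supported in some set of exponents,
  so it is recorded by that set; \<open>Q = {}\<close> stands for the zero subspace.\<close>

abbreviation cls :: "'u set \<Rightarrow> 'u series \<Rightarrow> 'u series set" where
  "cls Q \<equiv> proj_class (power_series Q)"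

lemma mem_proj_class_iff:
  "g \<in> cls Q h \<longleftrightarrow> (\<exists>c b. c \<noteq> 0 \<and> b \<in> power_series Q \<and> g = (\<lambda>x. c * h x + b x))"
proof
  assume "g \<in> cls Q h"
  then obtain c where "c \<noteq> 0" "(\<lambda>x. g x - c * h x) \<in> power_series Q" by (auto simp: proj_class_def)
  then show "\<exists>c b. c \<noteq> 0 \<and> b \<in> power_series Q \<and> g = (\<lambda>x. c * h x + b x)"
    by (intro exI[of _ c] exI[of _ "\<lambda>x. g x - c * h x"]) auto
qed (auto simp: proj_class_def)

lemma proj_class_self [simp]: "h \<in> cls Q h"
  unfolding mem_proj_class_iff by (intro exI[of _ 1] exI[of _ "\<lambda>_. 0"]) (auto simp: power_series_zero)

lemma proj_class_subset: "g \<in> cls Q h \<Longrightarrow> cls Q g \<subseteq> cls Q h"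
proof
  fix f assume "g \<in> cls Q h" "f \<in> cls Q g"
  then obtain c b d e where 1: "c \<noteq> 0" "b \<in> power_series Q" "g = (\<lambda>x. c * h x + b x)"
    "d \<noteq> 0" "e \<in> power_series Q" "f = (\<lambda>x. d * g x + e x)"
    unfolding mem_proj_class_iff by metis
  then have "f = (\<lambda>x. (d * c) * h x + (d * b x + e x))" by (auto simp: algebra_simps)
  moreover have "(\<lambda>x. d * b x + e x) \<in> power_series Q" using 1 by (intro power_series_lin)
  ultimately show "f \<in> cls Q h" unfolding mem_proj_class_iff using 1 by (metis mult_eq_0_iff)
qed

lemma proj_class_sym: "g \<in> cls Q h \<Longrightarrow> h \<in> cls Q g"
proof -
  assume "g \<in> cls Q h"
  then obtain c b where 1: "c \<noteq> 0" "b \<in> power_series Q" "g = (\<lambda>x. c * h x + b x)"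
    unfolding mem_proj_class_iff by metis
  then have "h = (\<lambda>x. (1 / c) * g x + (- 1 / c * b x + 0))" by (auto simp: field_simps)
  moreover have "(\<lambda>x. - 1 / c * b x + 0) \<in> power_series Q" using 1 by (intro power_series_lin power_series_zero)
  moreover have "1 / c \<noteq> 0" using 1 by simp
  ultimately show "h \<in> cls Q g" unfolding mem_proj_class_iff by metis
qed

lemma proj_class_eq_iff: "cls Q g = cls Q h \<longleftrightarrow> g \<in> cls Q h"
  using proj_class_subset proj_class_sym proj_class_self by blast

text \<open>Unions of classes modulo \<open>Q\<close>, that is, full preimages of sets of classes.
  For these, images under \<open>cls Q\<close> commute with intersections.\<close>

definition saturated :: "'u set \<Rightarrow> 'u series set \<Rightarrow> bool" where
  "saturated Q S \<longleftrightarrow> (\<forall>h\<in>S. \<forall>c b. c \<noteq> 0 \<longrightarrow> b \<in> power_series Q \<longrightarrow> (\<lambda>x. c * h x + b x) \<in> S)"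

lemma saturated_iff: "saturated Q S \<longleftrightarrow> (\<forall>h\<in>S. cls Q h \<subseteq> S)"
  unfolding saturated_def subset_iff mem_proj_class_iff by blast

lemma saturated_Int: "saturated Q S \<Longrightarrow> saturated Q T \<Longrightarrow> saturated Q (S \<inter> T)"
  by (auto simp: saturated_def)

lemma saturated_Un: "saturated Q S \<Longrightarrow> saturated Q T \<Longrightarrow> saturated Q (S \<union> T)"
  by (auto simp: saturated_def)

lemma saturated_vimage: "saturated Q S \<Longrightarrow> cls Q h \<in> cls Q ` S \<longleftrightarrow> h \<in> S"
  unfolding saturated_iff image_iff proj_class_eq_iff by (metis proj_class_self subsetD)

text \<open>The construction of \<open>proj_top\<close> for an arbitrary set of series, so that each
  cone has its own projectivization.\<close>

definition qtop :: "'u set \<Rightarrow> 'u series set \<Rightarrow> 'u series set topology" where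
  "qtop Q S = quotient_top (top_of_set S) (cls Q)"

lemma topspace_qtop [simp]: "topspace (qtop Q S) = cls Q ` S"
  by (simp add: qtop_def)

lemma quotient_map_qtop: "quotient_map (top_of_set S) (qtop Q S) (cls Q)"
  unfolding qtop_def by (rule quotient_map_quotient_top)

lemma continuous_map_qtop: "continuous_map (top_of_set S) (qtop Q S) (cls Q)"
  using quotient_imp_continuous_map quotient_map_qtop by blast

lemma continuous_on_coordinate [continuous_intros]:
  "continuous_on A (\<lambda>h::'u series. h u)"
  by (rule continuous_on_product_then_coordinatewise[OF continuous_on_id])

text \<open>The union of the classes meeting an open \<open>W\<close> is the union of the preimages
  of \<open>W\<close> under the maps sending \<open>h\<close> to \<open>c * h + b\<close>, which are
  continuous self-maps of a saturated \<open>S\<close>.\<close>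

lemma open_map_qtop:
  assumes "saturated Q S" shows "open_map (top_of_set S) (qtop Q S) (cls Q)"
  unfolding open_map_def
proof (intro allI impI)
  fix W assume W: "openin (top_of_set S) W"
  then have "W \<subseteq> S" by (simp add: openin_imp_subset)
  let ?I = "{(c, b). c \<noteq> 0 \<and> b \<in> power_series Q}"
  have "{x \<in> S. cls Q x \<in> cls Q ` W} = (\<Union>(c, b)\<in>?I. {x \<in> S. (\<lambda>u. c * x u + b u) \<in> W})"
  proof -
    have "cls Q x \<in> cls Q ` W \<longleftrightarrow> (\<exists>(c, b)\<in>?I. (\<lambda>u. c * x u + b u) \<in> W)" for x
    proof -
      have "cls Q x \<in> cls Q ` W \<longleftrightarrow> (\<exists>w\<in>W. w \<in> cls Q x)"
        unfolding image_iff proj_class_eq_iff using proj_class_sym by blast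
      then show ?thesis unfolding mem_proj_class_iff by auto
    qed
    then show ?thesis by auto
  qed
  moreover have "openin (top_of_set S) {x \<in> S. (\<lambda>u. c * x u + b u) \<in> W}" if "(c, b) \<in> ?I" for c b
  proof -
    have "continuous_on S (\<lambda>x u. c * x u + b u)"
      by (intro continuous_on_coordinatewise_then_product continuous_intros)
    moreover have "(\<lambda>x u. c * x u + b u) \<in> S \<rightarrow> S" using that assms by (auto simp: saturated_def)
    ultimately have "continuous_map (top_of_set S) (top_of_set S) (\<lambda>x u. c * x u + b u)" by auto
    from openin_continuous_map_preimage[OF this W] show ?thesis by simp
  qed
  ultimately have "openin (top_of_set S) {x \<in> S. cls Q x \<in> cls Q ` W}" by auto
  then show "openin (qtop Q S) (cls Q ` W)"
    unfolding qtop_def openin_quotient_top using \<open>W \<subseteq> S\<close> by auto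
qed

text \<open>An open map stays open when restricted to a full preimage, so the projection of
  \<open>T\<close> is a quotient map onto the subspace as well.\<close>

lemma subtopology_qtop:
  assumes "saturated Q S" "saturated Q T" "T \<subseteq> S"
  shows "subtopology (qtop Q S) (cls Q ` T) = qtop Q T"
proof (rule quotient_map_unique)
  show "quotient_map (top_of_set T) (qtop Q T) (cls Q)" by (rule quotient_map_qtop)
  have "{x \<in> topspace (top_of_set S). cls Q x \<in> cls Q ` T} = T"
    using assms saturated_vimage[OF assms(2)] by auto
  from open_map_restriction[OF open_map_qtop[OF assms(1)] this]
  have "open_map (top_of_set T) (subtopology (qtop Q S) (cls Q ` T)) (cls Q)"
    using assms(3) by (simp add: subtopology_subtopology Int_absorb1)
  moreover have "continuous_map (top_of_set T) (subtopology (qtop Q S) (cls Q ` T)) (cls Q)"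
  proof -
    have "continuous_map (subtopology (top_of_set S) T) (qtop Q S) (cls Q)"
      by (intro continuous_map_from_subtopology continuous_map_qtop)
    then show ?thesis using assms(3)
      by (auto simp: continuous_map_in_subtopology subtopology_subtopology Int_absorb1)
  qed
  ultimately show "quotient_map (top_of_set T) (subtopology (qtop Q S) (cls Q ` T)) (cls Q)"
    by (intro continuous_open_imp_quotient_map) (use assms(3) in auto)
qed

section \<open>Maps and homotopies that descend to classes\<close>

definition induced :: "'u set \<Rightarrow> ('u series \<Rightarrow> 'u series) \<Rightarrow> 'u series set \<Rightarrow> 'u series set" where
  "induced Q f p = cls Q (f (SOME h. h \<in> p))"

text \<open>The choice of representative is harmless: another one is \<open>c * h + b\<close> with
  \<open>b\<close> supported in \<open>Q\<close>, and linearity keeps its image in the class of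
  \<open>f h\<close>.\<close>

lemma induced_proj_class:
  assumes "\<And>c h b. f (\<lambda>x. c * h x + b x) = (\<lambda>x. c * f h x + f b x)"
    "\<And>b. b \<in> power_series Q \<Longrightarrow> f b \<in> power_series Q"
  shows "induced Q f (cls Q h) = cls Q (f h)"
proof -
  have "(SOME g. g \<in> cls Q h) \<in> cls Q h" by (rule someI[of _ h]) simp
  then obtain c b where "c \<noteq> 0" "b \<in> power_series Q" "(SOME g. g \<in> cls Q h) = (\<lambda>x. c * h x + b x)"
    unfolding mem_proj_class_iff by auto
  then have "f (SOME g. g \<in> cls Q h) \<in> cls Q (f h)"
    unfolding mem_proj_class_iff using assms by (intro exI[of _ c] exI[of _ "f b"]) simp
  then show ?thesis by (simp add: induced_def proj_class_eq_iff)
qed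

text \<open>The unit interval is locally compact and Hausdorff, so its product with a quotient map
  is again a quotient map and joint continuity may be checked on series.\<close>

lemma homotopic_induced:
  fixes F :: "real \<Rightarrow> 'u series \<Rightarrow> 'u series"
  assumes lin: "\<And>t c h b. F t (\<lambda>x. c * h x + b x) = (\<lambda>x. c * F t h x + F t b x)"
    and Q: "\<And>t b. b \<in> power_series Q \<Longrightarrow> F t b \<in> power_series Q"
    and im: "\<And>t h. 0 \<le> t \<Longrightarrow> t \<le> 1 \<Longrightarrow> h \<in> S \<Longrightarrow> F t h \<in> T"
    and cont: "continuous_on ({0..1} \<times> S) (\<lambda>(t, h). F t h)"
  shows "homotopic_with (\<lambda>_. True) (qtop Q S) (qtop Q T) (induced Q (F 0)) (induced Q (F 1))"
proof -
  let ?I = "top_of_set {0..1::real}"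
  have q: "quotient_map (prod_topology ?I (top_of_set S)) (prod_topology ?I (qtop Q S)) (\<lambda>(t, h). (t, cls Q h))"
  proof (intro quotient_map_prod_right quotient_map_qtop disjI1)
    show "locally_compact_space ?I"
      by (intro compact_imp_locally_compact_space) (simp add: compact_space_subtopology)
    show "Hausdorff_space ?I" by (intro Hausdorff_space_subtopology) simp
  qed
  have "continuous_map (prod_topology ?I (qtop Q S)) (qtop Q T) (\<lambda>(t, p). induced Q (F t) p)"
  proof (rule continuous_compose_quotient_map[OF q])
    have eq: "(\<lambda>(t, p). induced Q (F t) p) \<circ> (\<lambda>(t, h). (t, cls Q h)) = cls Q \<circ> (\<lambda>(t, h). F t h)"
    proof -
      have "induced Q (F t) (cls Q h) = cls Q (F t h)" for t h
        by (rule induced_proj_class) (use lin Q in auto)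
      then show ?thesis by auto
    qed
    have "continuous_map (prod_topology ?I (top_of_set S)) (top_of_set T) (\<lambda>(t, h). F t h)"
      using cont im by (auto simp: prod_topology_subtopology_eu)
    then show "continuous_map (prod_topology ?I (top_of_set S)) (qtop Q T)
        ((\<lambda>(t, p). induced Q (F t) p) \<circ> (\<lambda>(t, h). (t, cls Q h)))"
      unfolding eq using continuous_map_qtop by (rule continuous_map_compose)
  qed
  then show ?thesis unfolding homotopic_with_def by (intro exI[of _ "\<lambda>(t, p). induced Q (F t) p"]) auto
qed

text \<open>The inclusion of \<open>S\<close> and the end map \<open>F 1\<close> are mutually
  inverse up to homotopy; \<open>F\<close> itself provides both homotopies because it preserves
  \<open>S\<close> as well as \<open>T\<close>.\<close>

lemma qtop_deformation:
  fixes F :: "real \<Rightarrow> 'u series \<Rightarrow> 'u series"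
  assumes lin: "\<And>t c h b. F t (\<lambda>x. c * h x + b x) = (\<lambda>x. c * F t h x + F t b x)"
    and Q: "\<And>t b. b \<in> power_series Q \<Longrightarrow> F t b \<in> power_series Q"
    and "S \<subseteq> T"
    and T: "\<And>t h. 0 \<le> t \<Longrightarrow> t \<le> 1 \<Longrightarrow> h \<in> T \<Longrightarrow> F t h \<in> T"
    and S: "\<And>t h. 0 \<le> t \<Longrightarrow> t \<le> 1 \<Longrightarrow> h \<in> S \<Longrightarrow> F t h \<in> S"
    and 1: "\<And>h. h \<in> T \<Longrightarrow> F 1 h \<in> S" and 0: "\<And>h. F 0 h = h"
    and cont: "continuous_on ({0..1} \<times> T) (\<lambda>(t, h). F t h)"
  shows "qtop Q T homotopy_equivalent_space qtop Q S"
proof -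
  have cS: "continuous_on ({0..1} \<times> S) (\<lambda>(t, h). F t h)"
    by (rule continuous_on_subset[OF cont]) (use \<open>S \<subseteq> T\<close> in auto)
  have ind0: "induced Q (F 0) p = p" if "p \<in> cls Q ` T" for p
    using that induced_proj_class[of "F 0", OF lin Q] 0 by auto
  have hT: "homotopic_with (\<lambda>_. True) (qtop Q T) (qtop Q T) (induced Q (F 0)) (induced Q (F 1))"
    by (rule homotopic_induced[OF lin Q T cont])
  have hS: "homotopic_with (\<lambda>_. True) (qtop Q S) (qtop Q S) (induced Q (F 0)) (induced Q (F 1))"
    by (rule homotopic_induced[OF lin Q S cS])
  \<comment> \<open>A constant homotopy, taken only for the continuity of the induced map
    \<open>F 1\<close> into the smaller space.\<close>
  have "homotopic_with (\<lambda>_. True) (qtop Q T) (qtop Q S) (induced Q (F 1)) (induced Q (F 1))"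
  proof (rule homotopic_induced[of "\<lambda>_. F 1"])
    show "continuous_on ({0..1::real} \<times> T) (\<lambda>(t, h). F 1 h)"
    proof -
      have "continuous_on ({0..1::real} \<times> T) ((\<lambda>(t, h). F t h) \<circ> (\<lambda>(t, h). (1, h)))"
      proof (intro continuous_on_compose continuous_on_subset[OF cont])
        show "continuous_on ({0..1::real} \<times> T) (\<lambda>(t, h). (1::real, h))"
          unfolding split_def
          by (rule continuous_on_Pair[OF continuous_on_const continuous_on_snd[OF continuous_on_id]])
      qed auto
      then show ?thesis by (simp add: o_def split_def)
    qed
  qed (use lin Q 1 in auto)
  then have c1: "continuous_map (qtop Q T) (qtop Q S) (induced Q (F 1))"
    using homotopic_with_imp_continuous_maps by blast
  \<comment> \<open>Of this homotopy only the start is wanted: \<open>F 0\<close> is the identity on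
    series, so it induces the inclusion.\<close>
  have "homotopic_with (\<lambda>_. True) (qtop Q S) (qtop Q T) (induced Q (F 0)) (induced Q (F 1))"
    by (rule homotopic_induced[OF lin Q _ cS]) (use T \<open>S \<subseteq> T\<close> in auto)
  then have c2: "continuous_map (qtop Q S) (qtop Q T) (induced Q (F 0))"
    using homotopic_with_imp_continuous_maps by blast
  then have c2: "continuous_map (qtop Q S) (qtop Q T) id"
    by (rule continuous_map_eq) (use ind0 \<open>S \<subseteq> T\<close> in auto)
  have "homotopic_with (\<lambda>_. True) (qtop Q T) (qtop Q T) (id \<circ> induced Q (F 1)) id"
    by (rule homotopic_with_eq[OF homotopic_with_symD[OF hT]]) (use ind0 in auto)
  moreover have "homotopic_with (\<lambda>_. True) (qtop Q S) (qtop Q S) (induced Q (F 1) \<circ> id) id"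
    by (rule homotopic_with_eq[OF homotopic_with_symD[OF hS]]) (use ind0 \<open>S \<subseteq> T\<close> in auto)
  ultimately show ?thesis unfolding homotopy_equivalent_space_def using c1 c2 by blast
qed

section \<open>Euler characteristics of projectivized cones\<close>

definition cone_euler :: "'u set \<Rightarrow> 'u series set \<Rightarrow> int \<Rightarrow> bool" where
  "cone_euler Q S e \<longleftrightarrow> has_euler (qtop Q S) {} e"

lemma cone_euler_Mayer_Vietoris:
  assumes "saturated Q S" "saturated Q T"
    and op: "openin (top_of_set (S \<union> T)) S" "openin (top_of_set (S \<union> T)) T"
    and "cone_euler Q S a" "cone_euler Q T b"
  shows "cone_euler Q (S \<inter> T) c \<Longrightarrow> cone_euler Q (S \<union> T) (a + b - c)"
    and "cone_euler Q (S \<union> T) e \<Longrightarrow> cone_euler Q (S \<inter> T) (a + b - e)"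
proof -
  have sat: "saturated Q (S \<union> T)" "saturated Q (S \<inter> T)"
    using assms saturated_Un saturated_Int by auto
  have "cls Q ` S \<inter> cls Q ` T = cls Q ` (S \<inter> T)"
    using saturated_vimage[OF assms(1)] saturated_vimage[OF assms(2)] by blast
  moreover have "openin (qtop Q (S \<union> T)) (cls Q ` S)" "openin (qtop Q (S \<union> T)) (cls Q ` T)"
    using open_map_qtop[OF sat(1)] op by (auto simp: open_map_def)
  moreover have "subtopology (qtop Q (S \<union> T)) (cls Q ` S) = qtop Q S"
    "subtopology (qtop Q (S \<union> T)) (cls Q ` T) = qtop Q T"
    "subtopology (qtop Q (S \<union> T)) (cls Q ` (S \<inter> T)) = qtop Q (S \<inter> T)"
    by (intro subtopology_qtop sat assms; blast)+
  ultimately show "cone_euler Q (S \<inter> T) c \<Longrightarrow> cone_euler Q (S \<union> T) (a + b - c)"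
    "cone_euler Q (S \<union> T) e \<Longrightarrow> cone_euler Q (S \<inter> T) (a + b - e)"
    using has_euler_Mayer_Vietoris[of "qtop Q (S \<union> T)" "cls Q ` S" "cls Q ` T" a b] assms(5,6)
    unfolding cone_euler_def by (auto simp: image_Un)
qed


section \<open>Cones defined by non-vanishing of coordinates\<close>

lemma continuous_on_snd_coordinate [continuous_intros]:
  "continuous_on A (\<lambda>p::real \<times> 'u series. snd p u)"
  by (rule continuous_on_product_then_coordinatewise[OF continuous_on_snd[OF continuous_on_id]])

text \<open>The coordinates in \<open>P\<close> outside \<open>K\<close> are free. For non-empty
  \<open>K\<close> disjoint from \<open>Q\<close> the projectivization is a vector bundle over the
  projectivized torus of \<open>K\<close>.\<close>

definition torus_cone :: "'u set \<Rightarrow> 'u set \<Rightarrow> 'u series set" where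
  "torus_cone P K = {h \<in> power_series P. \<forall>u\<in>K. h u \<noteq> 0}"

definition ratio_cone :: "'u set \<Rightarrow> 'u set \<Rightarrow> 'u \<Rightarrow> 'u \<Rightarrow> complex set \<Rightarrow> 'u series set" where
  "ratio_cone P K w u D = {h \<in> torus_cone P K. h w / h u \<in> D}"

text \<open>Singletons give tori, and the single set \<open>P - Q\<close> gives all series outside
  the denominator; fibres lie in between. One form thus covers all the spaces to be
  measured.\<close>

definition meet_cone :: "'u set \<Rightarrow> 'u set set \<Rightarrow> 'u series set" where
  "meet_cone P \<T> = {h \<in> power_series P. \<forall>T\<in>\<T>. \<exists>u\<in>T. h u \<noteq> 0}"

lemma power_series_off: "b \<in> power_series Q \<Longrightarrow> u \<notin> Q \<Longrightarrow> b u = 0"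
  by (auto simp: power_series_def)

lemma saturated_meet_cone:
  "Q \<subseteq> P \<Longrightarrow> (\<And>T. T \<in> \<T> \<Longrightarrow> T \<inter> Q = {}) \<Longrightarrow> saturated Q (meet_cone P \<T>)"
  unfolding saturated_def
proof (intro ballI allI impI)
  fix h b :: "'a series" and c :: complex
  assume *: "Q \<subseteq> P" "\<And>T. T \<in> \<T> \<Longrightarrow> T \<inter> Q = {}" "h \<in> meet_cone P \<T>" "c \<noteq> 0" "b \<in> power_series Q"
  have "\<exists>u\<in>T. c * h u + b u \<noteq> 0" if T: "T \<in> \<T>" for T
  proof -
    obtain u where u: "u \<in> T" "h u \<noteq> 0" using * T by (auto simp: meet_cone_def)
    then have "u \<notin> Q" using *(2)[OF T] by auto
    then show ?thesis using u \<open>c \<noteq> 0\<close> power_series_off[OF *(5)] by (intro bexI[of _ u]) auto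
  qed
  moreover have "(\<lambda>x. c * h x + b x) \<in> power_series P"
    using * power_series_mono[OF *(1)] by (auto simp: meet_cone_def intro!: power_series_lin)
  ultimately show "(\<lambda>x. c * h x + b x) \<in> meet_cone P \<T>" by (simp add: meet_cone_def)
qed

lemma torus_cone_eq_meet_cone: "torus_cone P K = meet_cone P ((\<lambda>u. {u}) ` K)"
  by (auto simp: torus_cone_def meet_cone_def)

lemma saturated_torus_cone: "Q \<subseteq> P \<Longrightarrow> K \<inter> Q = {} \<Longrightarrow> saturated Q (torus_cone P K)"
  unfolding torus_cone_eq_meet_cone by (rule saturated_meet_cone) auto

lemma saturated_ratio_cone:
  "Q \<subseteq> P \<Longrightarrow> K \<inter> Q = {} \<Longrightarrow> w \<in> K \<Longrightarrow> u \<in> K \<Longrightarrow> saturated Q (ratio_cone P K w u D)"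
  unfolding saturated_def
proof (intro ballI allI impI)
  fix h b :: "'a series" and c :: complex
  assume *: "Q \<subseteq> P" "K \<inter> Q = {}" "w \<in> K" "u \<in> K" "h \<in> ratio_cone P K w u D" "c \<noteq> 0" "b \<in> power_series Q"
  then have "b w = 0" "b u = 0" using power_series_off[OF *(7)] by auto
  moreover have "(\<lambda>x. c * h x + b x) \<in> torus_cone P K"
    using saturated_torus_cone[OF *(1,2)] * by (auto simp: saturated_def ratio_cone_def)
  ultimately show "(\<lambda>x. c * h x + b x) \<in> ratio_cone P K w u D" using * by (auto simp: ratio_cone_def)
qed

lemma cone_euler_deformation:
  fixes F :: "real \<Rightarrow> 'u series \<Rightarrow> 'u series"
  assumes lin: "\<And>t c h b. F t (\<lambda>x. c * h x + b x) = (\<lambda>x. c * F t h x + F t b x)"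
    and Q: "\<And>t b. b \<in> power_series Q \<Longrightarrow> F t b \<in> power_series Q"
    and "S \<subseteq> T"
    and T: "\<And>t h. 0 \<le> t \<Longrightarrow> t \<le> 1 \<Longrightarrow> h \<in> T \<Longrightarrow> F t h \<in> T"
    and S: "\<And>t h. 0 \<le> t \<Longrightarrow> t \<le> 1 \<Longrightarrow> h \<in> S \<Longrightarrow> F t h \<in> S"
    and 1: "\<And>h. h \<in> T \<Longrightarrow> F 1 h \<in> S" and 0: "\<And>h. F 0 h = h"
    and cont: "continuous_on ({0..1} \<times> T) (\<lambda>(t, h). F t h)"
  shows "cone_euler Q S e \<longleftrightarrow> cone_euler Q T e"
  using qtop_deformation[OF assms] has_euler_homotopy_equivalent homotopy_equivalent_space_sym
  unfolding cone_euler_def by blast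

text \<open>All coordinates except \<open>u\<close> are scaled down to zero.\<close>

lemma cone_euler_torus_singleton:
  assumes "Q \<subseteq> P" "u \<in> P - Q" shows "cone_euler Q (torus_cone P {u}) 1"
proof -
  define F :: "real \<Rightarrow> 'a series \<Rightarrow> 'a series"
    where "F t h = (\<lambda>x. (if x = u then 1 else complex_of_real (1 - t)) * h x)" for t h
  \<comment> \<open>The coordinates in \<open>Q\<close> are divided out and the one at
    \<open>u\<close> can be normalized to 1, so this cone has a single class.\<close>
  let ?S = "torus_cone (insert u Q) {u}"
  have "cls Q ` ?S = {cls Q (\<lambda>x. if x = u then 1 else 0)}" (is "_ = {cls Q ?\<delta>}")
  proof -
    have "cls Q h = cls Q ?\<delta>" if "h \<in> ?S" for h
      unfolding proj_class_eq_iff mem_proj_class_iff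
    proof (intro exI conjI)
      show "h u \<noteq> 0" "(\<lambda>x. if x = u then 0 else h x) \<in> power_series Q"
        using that by (auto simp: torus_cone_def power_series_def)
      show "h = (\<lambda>x. h u * (if x = u then 1 else 0) + (if x = u then 0 else h x))" by auto
    qed
    then have "cls Q ` ?S = (\<lambda>_. cls Q ?\<delta>) ` ?S" by (rule image_cong[OF refl])
    moreover have "?\<delta> \<in> ?S" by (auto simp: torus_cone_def power_series_def)
    ultimately show ?thesis by (metis image_constant)
  qed
  then have "cone_euler Q ?S 1" unfolding cone_euler_def
    by (intro has_euler_singleton) simp
  moreover have "cone_euler Q ?S 1 \<longleftrightarrow> cone_euler Q (torus_cone P {u}) 1"
  proof (rule cone_euler_deformation[of F])
    show "continuous_on ({0..1} \<times> torus_cone P {u}) (\<lambda>(t, h). F t h)"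
      unfolding F_def split_def
    proof (rule continuous_on_coordinatewise_then_product)
      fix i
      show "continuous_on ({0..1} \<times> torus_cone P {u})
          (\<lambda>p. (if i = u then 1 else complex_of_real (1 - fst p)) * snd p i)"
        by (cases "i = u") (auto intro!: continuous_intros)
    qed
  qed (use assms in \<open>auto simp: F_def torus_cone_def power_series_def algebra_simps\<close>)
  ultimately show ?thesis by simp
qed

text \<open>
  Moving \<open>h w / h u\<close> linearly to the star centre \<open>c\<close> deforms the larger cone, on which \<open>h w\<close> is
  arbitrary, into the cone where the quotient lies in \<open>D\<close>.
\<close>

lemma cone_euler_ratio_cone:
  assumes "Q \<subseteq> P" "K \<subseteq> P - Q" "w \<in> K" "u \<in> K" "u \<noteq> w" "0 \<notin> D" "c \<in> D"
    and star: "\<And>z t. z \<in> D \<Longrightarrow> 0 \<le> t \<Longrightarrow> t \<le> 1 \<Longrightarrow> complex_of_real (1 - t) * z + complex_of_real t * c \<in> D"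
    and "cone_euler Q (torus_cone P (K - {w})) e"
  shows "cone_euler Q (ratio_cone P K w u D) e"
proof -
  \<comment> \<open>Moving \<open>h w\<close> towards \<open>c * h u\<close>, instead of moving the
    quotient, makes \<open>F t\<close> linear in \<open>h\<close>, as is needed for it to act on
    classes.\<close>
  define F :: "real \<Rightarrow> 'a series \<Rightarrow> 'a series"
    where "F t h = (\<lambda>x. if x = w then complex_of_real (1 - t) * h w + complex_of_real t * c * h u else h x)" for t h
  have ps: "F t h \<in> power_series P" if "h \<in> power_series P" for t h
    using that assms by (auto simp: F_def power_series_def)
  have "cone_euler Q (ratio_cone P K w u D) e \<longleftrightarrow> cone_euler Q (torus_cone P (K - {w})) e"
  proof (rule cone_euler_deformation[of F])
    show "F t (\<lambda>x. c * h x + b x) = (\<lambda>x. c * F t h x + F t b x)" for t c h b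
      by (auto simp: F_def algebra_simps)
    show "F t b \<in> power_series Q" if "b \<in> power_series Q" for t b
    proof -
      have "b w = 0" "b u = 0" using assms power_series_off[OF that] by auto
      then have "F t b = b" by (auto simp: F_def)
      then show ?thesis using that by simp
    qed
    show "ratio_cone P K w u D \<subseteq> torus_cone P (K - {w})"
      by (auto simp: ratio_cone_def torus_cone_def)
    show "F t h \<in> torus_cone P (K - {w})" if "h \<in> torus_cone P (K - {w})" for t h
      using that ps by (auto simp: torus_cone_def) (auto simp: F_def)
    \<comment> \<open>In the larger cone \<open>h w\<close> may vanish; as soon as the new quotient
      lies in \<open>D\<close>, which omits 0, the new coordinate at \<open>w\<close> does
      not.\<close>
    have mem: "F t h \<in> ratio_cone P K w u D"
      if h: "h \<in> torus_cone P (K - {w})" and D: "complex_of_real (1 - t) * (h w / h u) + complex_of_real t * c \<in> D" for t h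
    proof -
      have "h u \<noteq> 0" using h assms by (auto simp: torus_cone_def)
      then have "F t h w / F t h u = complex_of_real (1 - t) * (h w / h u) + complex_of_real t * c"
        using \<open>u \<noteq> w\<close> by (simp add: F_def field_simps)
      with D have r: "F t h w / F t h u \<in> D" by simp
      then have "F t h w \<noteq> 0" using \<open>0 \<notin> D\<close> by auto
      moreover have "F t h v = h v" if "v \<noteq> w" for v using that by (simp add: F_def)
      ultimately have "F t h v \<noteq> 0" if "v \<in> K" for v
        using h that by (cases "v = w") (auto simp: torus_cone_def)
      then have "F t h \<in> torus_cone P K"
        using h ps by (auto simp: torus_cone_def)
      with r show ?thesis by (simp add: ratio_cone_def)
    qed
    show "F t h \<in> ratio_cone P K w u D" if "0 \<le> t" "t \<le> 1" "h \<in> ratio_cone P K w u D" for t h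
    proof (rule mem)
      show "complex_of_real (1 - t) * (h w / h u) + complex_of_real t * c \<in> D"
        using that by (intro star) (auto simp: ratio_cone_def)
    qed (use that in \<open>auto simp: ratio_cone_def torus_cone_def\<close>)
    show "F 1 h \<in> ratio_cone P K w u D" if "h \<in> torus_cone P (K - {w})" for h
      using that \<open>c \<in> D\<close> by (intro mem) auto
    show "F 0 h = h" for h by (auto simp: F_def)
    show "continuous_on ({0..1} \<times> torus_cone P (K - {w})) (\<lambda>(t, h). F t h)"
      unfolding F_def split_def
    proof (rule continuous_on_coordinatewise_then_product)
      fix i
      show "continuous_on ({0..1} \<times> torus_cone P (K - {w}))
        (\<lambda>p. if i = w then complex_of_real (1 - fst p) * snd p w + complex_of_real (fst p) * c * snd p u else snd p i)"
        by (cases "i = w") (auto intro!: continuous_intros)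
    qed
  qed
  with assms show ?thesis by simp
qed

section \<open>Cutting a torus by the quotient of two coordinates\<close>

lemma openin_ratio_cone:
  assumes "open D" "u \<in> K"
  shows "openin (top_of_set (torus_cone P K)) (ratio_cone P K w u D)"
proof -
  have "continuous_on (torus_cone P K) (\<lambda>h. h w / h u)"
    using assms by (intro continuous_intros) (auto simp: torus_cone_def)
  from continuous_openin_preimage_gen[OF this \<open>open D\<close>]
  have "openin (top_of_set (torus_cone P K)) (torus_cone P K \<inter> (\<lambda>h. h w / h u) -` D)" .
  moreover have "torus_cone P K \<inter> (\<lambda>h. h w / h u) -` D = ratio_cone P K w u D"
    by (auto simp: ratio_cone_def)
  ultimately show ?thesis by simp
qed

lemma ratio_cone_Int: "ratio_cone P K w u D \<inter> ratio_cone P K w u E = ratio_cone P K w u (D \<inter> E)"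
  by (auto simp: ratio_cone_def)

lemma ratio_cone_Un: "ratio_cone P K w u D \<union> ratio_cone P K w u E = ratio_cone P K w u (D \<union> E)"
  by (auto simp: ratio_cone_def)

lemma cone_euler_empty: "cone_euler Q {} 0"
  unfolding cone_euler_def by (intro has_euler_empty) simp

lemma cone_euler_torus_step:
  assumes "Q \<subseteq> P" "K \<subseteq> P - Q" "w \<in> K" "u \<in> K" "u \<noteq> w"
    and e: "cone_euler Q (torus_cone P (K - {w})) e"
  shows "cone_euler Q (torus_cone P K) 0"
proof -
  let ?R = "ratio_cone P K w u"
  have sat: "saturated Q (?R D)" for D using assms by (intro saturated_ratio_cone) auto
  have op: "openin (top_of_set (?R (D \<union> E))) (?R D)" if "open D" for D E
    using openin_subset_trans[OF openin_ratio_cone[OF that \<open>u \<in> K\<close>, of P w], of "?R (D \<union> E)"]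
    by (auto simp: ratio_cone_def)
  have MV: "cone_euler Q (?R (D \<inter> E)) c \<Longrightarrow> cone_euler Q (?R (D \<union> E)) (a + b - c)"
    if "open D" "open E" "cone_euler Q (?R D) a" "cone_euler Q (?R E) b" for D E a b c
    using cone_euler_Mayer_Vietoris(1)[OF sat sat, of D E a b c] op[of D E] op[of E D] that
    by (simp add: ratio_cone_Un ratio_cone_Int Un_commute)
  note star = cone_euler_ratio_cone[OF assms(1-5) _ _ _ e]
  let ?P = "- \<real>\<^sub>\<le>\<^sub>0 :: complex set" and ?N = "- \<real>\<^sub>\<ge>\<^sub>0 :: complex set"
  let ?U = "{z. 0 < Im z}" and ?L = "{z. Im z < 0}"
  have P: "cone_euler Q (?R ?P) e"
  proof (rule star[of _ 1])
    fix z t assume z: "z \<in> ?P" and t: "0 \<le> t" "t \<le> (1::real)"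
    show "complex_of_real (1 - t) * z + complex_of_real t * 1 \<in> ?P"
    \<comment> \<open>At \<open>t = 1\<close> the centre is reached. Before that a non-zero
      imaginary part stays non-zero, so the real part matters only for real
      \<open>z\<close>.\<close>
    proof (cases "t = 1")
      case False
      then have "1 - t > 0" using t by simp
      moreover have "0 < (1 - t) * Re z + t" if "Re z > 0"
        using that t \<open>1 - t > 0\<close> by (simp add: add_pos_nonneg)
      ultimately show ?thesis using z by (auto simp: complex_nonpos_Reals_iff not_le)
    qed (auto simp: complex_nonpos_Reals_iff)
  qed (auto simp: complex_nonpos_Reals_iff)
  have N: "cone_euler Q (?R ?N) e"
  proof (rule star[of _ "-1"])
    fix z t assume z: "z \<in> ?N" and t: "0 \<le> t" "t \<le> (1::real)"
    show "complex_of_real (1 - t) * z + complex_of_real t * (-1) \<in> ?N"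
    proof (cases "t = 1")
      case False
      then have "1 - t > 0" using t by simp
      moreover have "(1 - t) * Re z - t < 0" if "Re z < 0"
        using mult_pos_neg[OF \<open>1 - t > 0\<close> that] t by linarith
      ultimately show ?thesis using z by (auto simp: complex_nonneg_Reals_iff not_le)
    qed (auto simp: complex_nonneg_Reals_iff)
  qed (auto simp: complex_nonneg_Reals_iff)
  have U: "cone_euler Q (?R ?U) e"
  proof (rule star[of _ \<i>])
    fix z t assume z: "z \<in> ?U" and t: "0 \<le> t" "t \<le> (1::real)"
    show "complex_of_real (1 - t) * z + complex_of_real t * \<i> \<in> ?U"
      using z t by (cases "t = 1") (auto intro!: add_pos_nonneg)
  qed auto
  have L: "cone_euler Q (?R ?L) e"
  proof (rule star[of _ "-\<i>"])
    fix z t assume z: "z \<in> ?L" and t: "0 \<le> t" "t \<le> (1::real)"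
    show "complex_of_real (1 - t) * z + complex_of_real t * (-\<i>) \<in> ?L"
      using z t mult_pos_neg[of "1 - t" "Im z"] by (cases "t = 1") auto
  qed auto
  have "cone_euler Q (?R (?U \<inter> ?L)) 0"
  proof -
    have "?R (?U \<inter> ?L) = {}" by (auto simp: ratio_cone_def)
    then show ?thesis using cone_euler_empty by simp
  qed
  from MV[OF _ _ U L this] have "cone_euler Q (?R (?U \<union> ?L)) (e + e - 0)"
    by (simp add: open_halfspace_Im_gt open_halfspace_Im_lt)
  moreover have "?U \<union> ?L = ?P \<inter> ?N"
    by (auto simp: complex_nonneg_Reals_iff complex_nonpos_Reals_iff)
  ultimately have "cone_euler Q (?R (?P \<inter> ?N)) (e + e)" by simp
  from MV[OF _ _ P N this] have "cone_euler Q (?R (?P \<union> ?N)) 0"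
    using closed_nonpos_Reals_complex closed_nonneg_Reals_complex by (simp add: open_Compl)
  moreover have "?P \<union> ?N = - {0}"
    by (auto simp: complex_nonneg_Reals_iff complex_nonpos_Reals_iff complex_eq_iff)
  moreover have "?R (- {0}) = torus_cone P K"
    using assms(3,4) by (auto simp: ratio_cone_def torus_cone_def)
  ultimately show ?thesis by simp
qed

lemma cone_euler_torus:
  assumes "Q \<subseteq> P" "K \<subseteq> P - Q" "finite K" "K \<noteq> {}"
  shows "cone_euler Q (torus_cone P K) (if card K = 1 then 1 else 0)"
  using assms(3,4,2)
proof (induction K rule: finite_ne_induct)
  case (singleton u)
  then show ?case using cone_euler_torus_singleton[OF assms(1), of u] by simp
next
  case (insert w K)
  then obtain u where "u \<in> K" by auto
  then have "cone_euler Q (torus_cone P (insert w K)) 0"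
    using cone_euler_torus_step[OF assms(1) insert.prems, of w u] insert by auto
  moreover have "card (insert w K) \<noteq> 1" using insert by (simp add: card_eq_0_iff)
  ultimately show ?case by simp
qed

theorem cone_euler_meet_cone:
  assumes "Q \<subseteq> P" "finite \<T>" "\<T> \<noteq> {}" "\<And>T. T \<in> \<T> \<Longrightarrow> finite T \<and> T \<subseteq> P - Q"
  shows "cone_euler Q (meet_cone P \<T>) (int (card (\<Inter>\<T>)))"
  using assms(2-4)
\<comment> \<open>The measure tells how far the sets are from being singletons. Natural subtraction
  lets an empty set count 0; such a set makes the cone empty and is settled directly.\<close>
proof (induction "\<Sum>T\<in>\<T>. card T - 1" arbitrary: \<T> rule: less_induct)
  case less
  consider (empty) "{} \<in> \<T>" | (single) "\<forall>T\<in>\<T>. card T = 1" | (big) T where "T \<in> \<T>" "card T > 1"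
    using less.prems(3) by (metis card_0_eq less_one linorder_neqE_nat)
  then show ?case
  proof cases
    case empty
    then have "meet_cone P \<T> = {}" "\<Inter>\<T> = {}" by (auto simp: meet_cone_def)
    then show ?thesis using cone_euler_empty by simp
  next
    case single
    \<comment> \<open>For singletons the intersection is non-empty only if all of them coincide,
      which is the one torus of Euler characteristic 1.\<close>
    define K where "K = \<Union>\<T>"
    have eq: "\<T> = (\<lambda>u. {u}) ` K" using single by (auto simp: K_def card_1_singleton_iff image_iff) blast
    have K: "finite K" "K \<subseteq> P - Q" using less.prems(1,3) unfolding K_def by auto
    have "K \<noteq> {}" using less.prems(2) eq by blast
    note K = K(1) this K(2)
    have "meet_cone P \<T> = torus_cone P K" unfolding eq by (auto simp: meet_cone_def torus_cone_def)
    moreover have "int (card (\<Inter>\<T>)) = (if card K = 1 then 1 else 0)"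
    proof (cases "card K = 1")
      case True
      then obtain u where "K = {u}" by (auto simp: card_1_singleton_iff)
      then show ?thesis unfolding eq by simp
    next
      case False
      have "\<Inter>\<T> = {}"
      proof (rule ccontr)
        assume "\<Inter>\<T> \<noteq> {}"
        then obtain x where "\<forall>u\<in>K. x = u" unfolding eq by auto
        then have "K = {x}" using K(2) by auto
        with False show False by simp
      qed
      with False show ?thesis by simp
    qed
    ultimately show ?thesis using cone_euler_torus[OF assms(1) K(3,1,2)] by simp
  next
    case big
    then have "T \<noteq> {}" by auto
    then obtain w where w: "w \<in> T" by blast
    define A where "A = T - {w}"
    define \<V> where "\<V> = \<T> - {T}"
    have fT: "finite T" "T \<subseteq> P - Q" using less.prems(3) big by auto
    have \<T>: "\<T> = insert T \<V>" "T \<notin> \<V>" "finite \<V>" using big less.prems by (auto simp: \<V>_def)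
    have T: "T = insert w A" "w \<notin> A" "finite A" using w fT by (auto simp: A_def)
    have cA: "card T = Suc (card A)" "card A \<ge> 1" using T big by auto
    define m where "m = (\<Sum>T\<in>\<V>. card T - 1)"
    have m: "(\<Sum>T\<in>\<T>. card T - 1) = m + card A" using \<T> cA by (simp add: m_def)
    \<comment> \<open>Only an inequality, since \<open>A\<close> or \<open>{w}\<close> may already
      belong to the family and is then not counted twice.\<close>
    have le: "(\<Sum>T\<in>insert X \<W>. card T - 1) \<le> (card X - 1) + (\<Sum>T\<in>\<W>. card T - 1)" if "finite \<W>" for X :: "'a set" and \<W>
      using that by (cases "X \<in> \<W>") (auto simp: insert_absorb)
    have m1: "(\<Sum>T\<in>insert A \<V>. card T - 1) < m + card A"
      using le[OF \<T>(3), of A] cA by (simp add: m_def)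
    have m2: "(\<Sum>T\<in>insert {w} \<V>. card T - 1) < m + card A"
      using le[OF \<T>(3), of "{w}"] cA by (simp add: m_def)
    have m3: "(\<Sum>T\<in>insert A (insert {w} \<V>). card T - 1) < m + card A"
      using le[of "insert {w} \<V>" A] le[OF \<T>(3), of "{w}"] \<T>(3) cA by (simp add: m_def)
    have el: "finite X \<and> X \<subseteq> P - Q" if "X = A \<or> X = {w} \<or> X \<in> \<V>" for X
      using that less.prems(3) fT w by (auto simp: A_def \<V>_def)
    have IH1: "cone_euler Q (meet_cone P (insert A \<V>)) (int (card (\<Inter>(insert A \<V>))))"
      by (rule less.hyps) (use m m1 el \<T>(3) in auto)
    have IH2: "cone_euler Q (meet_cone P (insert {w} \<V>)) (int (card (\<Inter>(insert {w} \<V>))))"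
      by (rule less.hyps) (use m m2 el \<T>(3) in auto)
    have IH3: "cone_euler Q (meet_cone P (insert A (insert {w} \<V>))) (int (card (\<Inter>(insert A (insert {w} \<V>)))))"
      by (rule less.hyps) (use m m3 el \<T>(3) in auto)
    have int: "meet_cone P (insert A \<V>) \<inter> meet_cone P (insert {w} \<V>) = meet_cone P (insert A (insert {w} \<V>))"
      by (auto simp: meet_cone_def)
    have un: "meet_cone P (insert A \<V>) \<union> meet_cone P (insert {w} \<V>) = meet_cone P \<T>"
      unfolding \<T>(1) T(1) by (auto simp: meet_cone_def)
    have op: "openin (top_of_set (meet_cone P \<T>)) (meet_cone P (insert X \<V>))" if "X \<subseteq> T" for X
    proof -
      have "open {h::'a series. h u \<noteq> 0}" for u
        by (intro open_Collect_neq continuous_on_coordinate continuous_on_const)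
      then have "open (\<Union>u\<in>X. {h::'a series. h u \<noteq> 0})" by auto
      moreover have "meet_cone P (insert X \<V>) = meet_cone P \<T> \<inter> (\<Union>u\<in>X. {h. h u \<noteq> 0})"
        unfolding \<T>(1) using that by (auto simp: meet_cone_def)
      ultimately show ?thesis by (auto simp: openin_open)
    qed
    have sat: "saturated Q (meet_cone P (insert X \<V>))" if "X \<subseteq> T" for X
      by (rule saturated_meet_cone[OF assms(1)]) (use that fT less.prems(3) in \<open>auto simp: \<V>_def\<close>)
    have "cone_euler Q (meet_cone P (insert A \<V>) \<union> meet_cone P (insert {w} \<V>))
       (int (card (\<Inter>(insert A \<V>))) + int (card (\<Inter>(insert {w} \<V>))) - int (card (\<Inter>(insert A (insert {w} \<V>)))))"
      by (rule cone_euler_Mayer_Vietoris(1)) (use sat op IH1 IH2 IH3 T in \<open>auto simp: un int\<close>)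
    \<comment> \<open>As \<open>w\<close> is not in \<open>A\<close>, the two intersections are
      disjoint and the correction term of Mayer-Vietoris counts an empty set.\<close>
    moreover have "\<Inter>\<T> = \<Inter>(insert A \<V>) \<union> \<Inter>(insert {w} \<V>)" "\<Inter>(insert A \<V>) \<inter> \<Inter>(insert {w} \<V>) = {}"
      "\<Inter>(insert A (insert {w} \<V>)) = {}"
      unfolding \<T>(1) T(1) using T(2) by auto
    moreover have "finite (\<Inter>(insert A \<V>))" "finite (\<Inter>(insert {w} \<V>))" using T(3) by auto
    ultimately show ?thesis by (simp add: un card_Un_disjoint)
  qed
qed


section \<open>Projectivized subquotients\<close>

lemma proj_space_power_series:
  "proj_space (power_series P) (power_series Q) = cls Q ` (power_series P - power_series Q)"
  by (simp add: proj_space_def)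

lemma proj_space_zero: "proj_space (power_series P) {\<lambda>_. 0} = cls {} ` (power_series P - {\<lambda>_. 0})"
  by (simp add: proj_space_def power_series_empty)

lemma mem_proj_class_empty: "g \<in> cls {} h \<longleftrightarrow> (\<exists>c. c \<noteq> 0 \<and> g = (\<lambda>x. c * h x))"
  unfolding mem_proj_class_iff by (auto simp: power_series_empty)

lemma saturated_power_series_diff:
  assumes "Q \<subseteq> P" shows "saturated Q (power_series P - power_series Q)"
  unfolding saturated_def
proof (intro ballI allI impI)
  fix h b :: "'a series" and c :: complex
  assume *: "h \<in> power_series P - power_series Q" "c \<noteq> 0" "b \<in> power_series Q"
  then obtain u where u: "h u \<noteq> 0" "u \<notin> Q" by (auto simp: power_series_def)
  then have "c * h u + b u \<noteq> 0" using * power_series_off[OF *(3) u(2)] by simp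
  then have "(\<lambda>x. c * h x + b x) \<notin> power_series Q" using u(2) by (auto simp: power_series_def)
  moreover have "(\<lambda>x. c * h x + b x) \<in> power_series P"
    using * power_series_mono[OF assms] by (intro power_series_lin) auto
  ultimately show "(\<lambda>x. c * h x + b x) \<in> power_series P - power_series Q" by simp
qed

text \<open>The set \<open>R\<close> allows for coordinates required to vanish. The subspace
  topology from the projective space of \<open>P\<close> modulo \<open>Q\<close> is that of the cone
  over \<open>R\<close>, to which the count applies.\<close>

lemma euler_char_proj_meet_cone:
  assumes "Q \<subseteq> R" "R \<subseteq> P" "finite \<T>" "\<T> \<noteq> {}" "\<And>T. T \<in> \<T> \<Longrightarrow> finite T \<and> T \<subseteq> R - Q"
  shows "euler_char_proj (power_series P) (power_series Q) (cls Q ` meet_cone R \<T>) = int (card (\<Inter>\<T>))"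
proof -
  have "meet_cone R \<T> \<subseteq> power_series P - power_series Q"
  proof
    fix h assume h: "h \<in> meet_cone R \<T>"
    obtain T where T: "T \<in> \<T>" using assms by blast
    then obtain u where "u \<in> T" "h u \<noteq> 0" using h by (auto simp: meet_cone_def)
    moreover have "u \<notin> Q" using assms(5)[OF T] \<open>u \<in> T\<close> by auto
    ultimately have "h \<notin> power_series Q" by (auto simp: power_series_def)
    then show "h \<in> power_series P - power_series Q"
      using h power_series_mono[OF assms(2)] by (auto simp: meet_cone_def)
  qed
  then have "subtopology (qtop Q (power_series P - power_series Q)) (cls Q ` meet_cone R \<T>) = qtop Q (meet_cone R \<T>)"
  proof (intro subtopology_qtop saturated_power_series_diff saturated_meet_cone)
    show "T \<inter> Q = {}" if "T \<in> \<T>" for T using assms(5)[OF that] by blast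
  qed (use assms in auto)
  moreover have "cone_euler Q (meet_cone R \<T>) (int (card (\<Inter>\<T>)))"
    using assms by (intro cone_euler_meet_cone) auto
  ultimately show ?thesis
    unfolding euler_char_proj_def proj_top_def qtop_def[symmetric] cone_euler_def
    by (metis has_euler_imp_euler_char)
qed

section \<open>Constructible sets\<close>

lemma constructible_subset: "constructible A B Y \<Longrightarrow> Y \<subseteq> proj_space A B"
  by (induction rule: constructible.induct) auto

lemma constructible_Int:
  assumes "constructible A B Y" "constructible A B Z" shows "constructible A B (Y \<inter> Z)"
proof -
  have "Y \<inter> Z = proj_space A B - ((proj_space A B - Y) \<union> (proj_space A B - Z))"
    using constructible_subset[OF assms(1)] by auto
  then show ?thesis using assms by (auto intro: constructible.intros)
qed

text \<open>The zero locus of the zero polynomial, a constant of degree 0.\<close>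

lemma constructible_proj_space: "constructible A B (proj_space A B)"
proof -
  have "constructible A B {p \<in> proj_space A B. \<forall>h\<in>p. (\<lambda>_. 0 :: complex) h = 0}"
    by (intro constructible.hypersurface[of B 0] hom_poly.const)
  then show ?thesis by simp
qed

lemma constructible_empty: "constructible A B {}"
  using constructible.complement[OF constructible_proj_space, of A B] by simp

lemma constructible_Inter:
  assumes "finite I" "\<And>i. i \<in> I \<Longrightarrow> constructible A B (Y i)"
  shows "constructible A B (proj_space A B \<inter> (\<Inter>i\<in>I. Y i))"
  using assms
proof (induction I rule: finite_induct)
  case empty
  then show ?case using constructible_proj_space by simp
next
  case (insert i I)
  have "proj_space A B \<inter> (\<Inter>i\<in>insert i I. Y i) = Y i \<inter> (proj_space A B \<inter> (\<Inter>i\<in>I. Y i))" by auto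
  then show ?case using insert by (auto intro: constructible_Int)
qed

lemma constructible_coordinate:
  assumes "u \<notin> Q"
  shows "constructible A (power_series Q) {p \<in> proj_space A (power_series Q). \<forall>h\<in>p. h u = 0}"
  using power_series_off[OF _ assms]
  by (intro constructible.hypersurface[of "power_series Q" 1] hom_poly.linear) (auto simp: linear_functional_def)

lemma proj_class_coordinate:
  assumes "u \<notin> Q" shows "(\<forall>g\<in>cls Q h. g u = 0) \<longleftrightarrow> h u = 0"
proof
  show "h u = 0" if "\<forall>g\<in>cls Q h. g u = 0" using that proj_class_self by blast
  show "\<forall>g\<in>cls Q h. g u = 0" if "h u = 0"
    using that power_series_off[OF _ assms] by (auto simp: mem_proj_class_iff)
qed

text \<open>Finitely many equations \<open>h u = 0\<close> for \<open>u\<close> in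
  \<open>P - R\<close> and, for each \<open>T\<close>, the complement of finitely many common zeros.
  Finiteness is asked of \<open>P - R\<close> instead of \<open>P\<close>, as jets come from an
  infinite set of exponents.\<close>

lemma constructible_meet_cone:
  assumes "R \<subseteq> P" "Q \<subseteq> R" "finite (P - R)" "finite \<T>" "\<T> \<noteq> {}"
    and T: "\<And>T. T \<in> \<T> \<Longrightarrow> finite T \<and> T \<inter> Q = {}"
  shows "constructible (power_series P) (power_series Q) (cls Q ` meet_cone R \<T>)"
proof -
  let ?X = "proj_space (power_series P) (power_series Q)"
  define Z where "Z u = {p \<in> ?X. \<forall>h\<in>p. h u = 0}" for u
  define N where "N T = ?X - (?X \<inter> (\<Inter>u\<in>T. Z u))" for T
  have Z: "cls Q h \<in> Z u \<longleftrightarrow> cls Q h \<in> ?X \<and> h u = 0" if "u \<notin> Q" for h u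
    using proj_class_coordinate[OF that] by (auto simp: Z_def)
  have N: "cls Q h \<in> N T \<longleftrightarrow> cls Q h \<in> ?X \<and> (\<exists>u\<in>T. h u \<noteq> 0)" if "T \<in> \<T>" for h T
    using Z T[OF that] by (auto simp: N_def disjoint_iff)
  have eq: "cls Q ` meet_cone R \<T> = (?X \<inter> (\<Inter>T\<in>\<T>. N T)) \<inter> (?X \<inter> (\<Inter>u\<in>P - R. Z u))" (is "?L = ?R")
  proof (intro equalityI subsetI)
    fix p assume "p \<in> ?L"
    then obtain h where h: "p = cls Q h" "h \<in> power_series R" "\<forall>T\<in>\<T>. \<exists>u\<in>T. h u \<noteq> 0"
      by (auto simp: meet_cone_def)
    obtain S u where S: "S \<in> \<T>" "u \<in> S" "h u \<noteq> 0" using assms(5) h by blast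
    then have "h \<notin> power_series Q" using T[OF S(1)] by (auto simp: power_series_def)
    then have X: "p \<in> ?X" using h power_series_mono[OF assms(1)] by (auto simp: proj_space_power_series)
    moreover have "p \<in> N T" if "T \<in> \<T>" for T using N[OF that] X h that by auto
    moreover have "p \<in> Z u" if "u \<in> P - R" for u
      using Z[of u h] X h that assms(2) power_series_off[OF h(2), of u] by auto
    ultimately show "p \<in> ?R" by auto
  next
    fix p assume p: "p \<in> ?R"
    then obtain h where h: "p = cls Q h" "h \<in> power_series P" by (auto simp: proj_space_power_series)
    have "h u = 0" if "u \<in> P - R" for u using Z[of u h] p h that assms(2) by auto
    then have "h \<in> power_series R" using h(2) by (auto simp: power_series_def)
    moreover have "\<exists>u\<in>T. h u \<noteq> 0" if "T \<in> \<T>" for T using N[OF that, of h] p h that by auto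
    ultimately show "p \<in> ?L" using h by (auto simp: meet_cone_def)
  qed
  have cZ: "constructible (power_series P) (power_series Q) (Z u)" if "u \<notin> Q" for u
    unfolding Z_def by (rule constructible_coordinate[OF that])
  have cN: "constructible (power_series P) (power_series Q) (N T)" if "T \<in> \<T>" for T
    unfolding N_def using T[OF that] cZ
    by (intro constructible.complement constructible_Inter) auto
  have "constructible (power_series P) (power_series Q) (?X \<inter> (\<Inter>T\<in>\<T>. N T))"
    by (rule constructible_Inter[OF assms(4) cN])
  moreover have "constructible (power_series P) (power_series Q) (?X \<inter> (\<Inter>u\<in>P - R. Z u))"
    by (rule constructible_Inter[OF assms(3) cZ]) (use assms(2) in auto)
  ultimately show ?thesis unfolding eq by (rule constructible_Int)
qed

section \<open>Monomial valuations\<close>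

definition wt :: "int ^ 'd \<Rightarrow> int ^ 'd \<Rightarrow> nat" where
  "wt v u = nat (pairing v u)"

lemma mon_val_ge_iff: "enat a \<le> mon_val v h \<longleftrightarrow> (\<forall>u. h u \<noteq> 0 \<longrightarrow> a \<le> wt v u)"
  by (simp add: mon_val_def le_INF_iff wt_def)

lemma mon_val_eq_iff:
  "mon_val v h = enat a \<longleftrightarrow> (\<forall>u. h u \<noteq> 0 \<longrightarrow> a \<le> wt v u) \<and> (\<exists>u. h u \<noteq> 0 \<and> wt v u = a)"
proof -
  have "mon_val v h = enat a \<longleftrightarrow> enat a \<le> mon_val v h \<and> \<not> enat (Suc a) \<le> mon_val v h"
    by (cases "mon_val v h") auto
  then show ?thesis unfolding mon_val_ge_iff by (metis le_antisym not_less_eq_eq)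
qed

text \<open>The value of a non-zero series is finite, being bounded by the weight of any exponent of
  its support.\<close>

lemma the_enat_mon_val_eq_iff:
  assumes "h \<noteq> (\<lambda>_. 0)" shows "the_enat (mon_val v h) = a \<longleftrightarrow> mon_val v h = enat a"
proof -
  obtain u where "h u \<noteq> 0" using assms by auto
  then have "\<not> enat (Suc (wt v u)) \<le> mon_val v h" unfolding mon_val_ge_iff by auto
  then obtain m where "mon_val v h = enat m" by (cases "mon_val v h") auto
  then show ?thesis by simp
qed

lemma mon_val_cong: "(\<And>u. g u = 0 \<longleftrightarrow> h u = 0) \<Longrightarrow> mon_val v g = mon_val v h"
  by (simp add: mon_val_def)

lemma t_nu_proj_class:
  fixes h :: "(int ^ 'd) series"
  shows "t_nu vs (cls {} h) = t_monomial (map (\<lambda>v. the_enat (mon_val v h)) vs)"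
proof -
  have "(SOME g. g \<in> cls {} h) \<in> cls {} h" by (rule someI[of _ h]) simp
  then obtain c where "c \<noteq> 0" "(SOME g. g \<in> cls {} h) = (\<lambda>x. c * h x)"
    by (auto simp: mem_proj_class_empty)
  then have "mon_val v (SOME g. g \<in> cls {} h) = mon_val v h" for v by (intro mon_val_cong) simp
  then show ?thesis by (simp add: t_nu_def)
qed

lemma t_monomial_inject: "t_monomial a = t_monomial b \<longleftrightarrow> a = b"
  unfolding t_monomial_def by (metis (mono_tags) zero_neq_one)

lemma t_monomial_nonzero: "t_monomial a \<noteq> (\<lambda>_. 0)"
  unfolding t_monomial_def by (metis (mono_tags) zero_neq_one)

section \<open>Ideals and truncations as coordinate subspaces\<close>

lemma val_ideal_eq: "val_ideal \<Lambda> v a = power_series {u \<in> \<Lambda>. a \<le> wt v u}"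
  by (auto simp: val_ideal_def mon_val_ge_iff power_series_def)

lemma truncated_series_eq: "truncated_series \<Lambda> v k = power_series {u \<in> \<Lambda>. wt v u \<le> k}"
  by (auto simp: truncated_series_def power_series_def wt_def)

text \<open>An interior \<open>v\<close> bounds the norm on the dual cone: the pairing with
  \<open>x\<close> is at least \<open>e / 2 * norm x\<close>. Bounded weight therefore leaves
  finitely many lattice points.\<close>

lemma finite_wt_le:
  fixes \<Lambda> :: "(int ^ 'd::finite) set"
  assumes "real_vec v \<in> interior (sigma_cone \<Lambda>)"
  shows "finite {u \<in> \<Lambda>. wt v u \<le> n}"
proof -
  obtain e where e: "e > 0" "ball (real_vec v) e \<subseteq> sigma_cone \<Lambda>"
    using assms by (auto simp: mem_interior)
  define M where "M = \<lceil>2 * real n / e\<rceil>"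
  have bound: "\<bar>u $ i\<bar> \<le> M" if u: "u \<in> \<Lambda>" "wt v u \<le> n" for u i
  proof -
    define x where "x = real_vec u"
    have inner: "real_vec v \<bullet> x = real_of_int (pairing v u)"
      by (simp add: x_def inner_vec_def real_vec_def pairing_def)
    have "norm x \<le> 2 * real n / e"
    proof (cases "x = 0")
      case False
      \<comment> \<open>Moving \<open>v\<close> by \<open>e / 2\<close> in the direction opposite to
        \<open>x\<close> stays within the ball; that the pairing with \<open>x\<close> remains
        non-negative is the desired estimate.\<close>
      define w where "w = real_vec v - (e / 2 / norm x) *\<^sub>R x"
      have "w \<in> ball (real_vec v) e" using False e by (simp add: w_def dist_norm)
      then have "w \<in> sigma_cone \<Lambda>" using e by auto
      moreover have "x \<in> sigma_dual \<Lambda>"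
        using u unfolding sigma_dual_def x_def by (intro hull_inc) auto
      ultimately have "0 \<le> w \<bullet> x" by (auto simp: sigma_cone_def)
      also have "w \<bullet> x = real_of_int (pairing v u) - e / 2 * norm x"
        using False by (simp add: w_def inner_diff_left inner power2_norm_eq_inner[symmetric] power2_eq_square)
      finally have "e / 2 * norm x \<le> real_of_int (pairing v u)" by simp
      also have "\<dots> \<le> real n" using u(2) by (simp add: wt_def)
      finally show ?thesis using e by (simp add: field_simps)
    qed (use e in simp)
    moreover have "\<bar>x $ i\<bar> \<le> norm x" by (rule component_le_norm_cart)
    ultimately have "real_of_int \<bar>u $ i\<bar> \<le> 2 * real n / e" by (simp add: x_def real_vec_def)
    then show ?thesis unfolding M_def by linarith
  qed
  have "{u \<in> \<Lambda>. wt v u \<le> n} \<subseteq> vec_lambda ` (UNIV \<rightarrow>\<^sub>E {-M..M})"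
  proof
    fix u assume u: "u \<in> {u \<in> \<Lambda>. wt v u \<le> n}"
    have "vec_nth u \<in> UNIV \<rightarrow>\<^sub>E {-M..M}"
    proof (rule PiE_I)
      fix i show "u $ i \<in> {-M..M}" using bound[of u i] u by auto
    qed simp
    then show "u \<in> vec_lambda ` (UNIV \<rightarrow>\<^sub>E {-M..M})" by (intro image_eqI[of _ _ "vec_nth u"]) simp_all
  qed
  moreover have "finite (vec_lambda ` ((UNIV :: 'd set) \<rightarrow>\<^sub>E {-M..M}))" by (intro finite_imageI finite_PiE) auto
  ultimately show ?thesis by (rule finite_subset)
qed

section \<open>The graded components\<close>

text \<open>Representatives of a class agree outside \<open>Q\<close>, and the best one is obtained
  by deleting the coordinates in \<open>Q\<close>. The supremum is therefore the minimum weight over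
  the rest of the support.\<close>

lemma induced_val_ge_iff:
  "enat a \<le> induced_val v (power_series Q) h \<longleftrightarrow> (\<forall>u. u \<notin> Q \<longrightarrow> h u \<noteq> 0 \<longrightarrow> a \<le> wt v u)"
proof
  assume a: "enat a \<le> induced_val v (power_series Q) h"
  show "\<forall>u. u \<notin> Q \<longrightarrow> h u \<noteq> 0 \<longrightarrow> a \<le> wt v u"
  proof (intro allI impI)
    fix u assume u: "u \<notin> Q" "h u \<noteq> 0"
    have "mon_val v g \<le> enat (wt v u)" if "(\<lambda>x. g x - h x) \<in> power_series Q" for g
    proof -
      have "g u \<noteq> 0" using power_series_off[OF that u(1)] u(2) by simp
      then show ?thesis unfolding mon_val_def wt_def by (intro INF_lower) simp
    qed
    then have "induced_val v (power_series Q) h \<le> enat (wt v u)"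
      unfolding induced_val_def by (intro SUP_least) simp
    with a have "enat a \<le> enat (wt v u)" by (rule order_trans)
    then show "a \<le> wt v u" by simp
  qed
next
  assume a: "\<forall>u. u \<notin> Q \<longrightarrow> h u \<noteq> 0 \<longrightarrow> a \<le> wt v u"
  define g where "g = (\<lambda>u. if u \<in> Q then 0 else h u)"
  have "enat a \<le> mon_val v g" unfolding mon_val_ge_iff using a by (auto simp: g_def)
  also have "mon_val v g \<le> induced_val v (power_series Q) h"
    unfolding induced_val_def by (rule SUP_upper) (auto simp: g_def power_series_def)
  finally show "enat a \<le> induced_val v (power_series Q) h" .
qed

text \<open>Exponents in \<open>Q\<close> stay in both members of the pair because they have been
  divided out already.\<close>

lemma gr_step_power_series:
  assumes "Q \<subseteq> P"
  shows "gr_step v a (power_series P, power_series Q) =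
    (power_series {u \<in> P. u \<in> Q \<or> a \<le> wt v u}, power_series {u \<in> P. u \<in> Q \<or> a + 1 \<le> wt v u})"
  unfolding gr_step_def prod.case induced_val_ge_iff by (auto simp: power_series_def)

text \<open>A step in degree \<open>a\<close> keeps of \<open>P - Q\<close> exactly the exponents of
  weight \<open>a\<close>. The start is a general pair, as each step changes both members.\<close>

lemma fold_gr_step:
  assumes "Q \<subseteq> P"
  shows "\<exists>P' Q'. fold (\<lambda>(v, a). gr_step v a) l (power_series P, power_series Q) = (power_series P', power_series Q')
    \<and> Q' \<subseteq> P' \<and> P' - Q' = {u \<in> P - Q. \<forall>(v, a)\<in>set l. wt v u = a}"
  using assms
proof (induction l arbitrary: P Q)
  case Nil
  then show ?case by auto
next
  case (Cons va l)
  obtain v a where va: "va = (v, a)" by (cases va)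
  define P1 where "P1 = {u \<in> P. u \<in> Q \<or> a \<le> wt v u}"
  define Q1 where "Q1 = {u \<in> P. u \<in> Q \<or> a + 1 \<le> wt v u}"
  have "Q1 \<subseteq> P1" by (auto simp: P1_def Q1_def)
  moreover have "P1 - Q1 = {u \<in> P - Q. wt v u = a}" by (auto simp: P1_def Q1_def)
  ultimately show ?case
    using Cons.IH[of Q1 P1] gr_step_power_series[OF Cons.prems, of v a, folded P1_def Q1_def]
    by (simp add: va conj_ac)
qed

section \<open>The fibres\<close>

text \<open>For \<open>z\<close> the set of all pairs of a valuation and its prescribed value, this
  is the set to be counted; \<open>L\<close> is either the semigroup or a finite truncation of
  it.\<close>

definition level :: "(int ^ 'd) set \<Rightarrow> ((int ^ 'd) \<times> nat) set \<Rightarrow> (int ^ 'd) set" where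
  "level L z = {u \<in> L. \<forall>(v, a)\<in>z. wt v u = a}"

definition above :: "(int ^ 'd) set \<Rightarrow> ((int ^ 'd) \<times> nat) set \<Rightarrow> (int ^ 'd) set" where
  "above L z = {u \<in> L. \<forall>(v, a)\<in>z. a \<le> wt v u}"

text \<open>One set of exponents for each prescribed value, namely those at which that value is
  attained.\<close>

definition faces :: "(int ^ 'd) set \<Rightarrow> ((int ^ 'd) \<times> nat) set \<Rightarrow> (int ^ 'd) set set" where
  "faces L z = (\<lambda>(v, a). {u \<in> above L z. wt v u = a}) ` z"

lemma Inter_faces: "z \<noteq> {} \<Longrightarrow> \<Inter>(faces L z) = level L z"
  by (fastforce simp: faces_def level_def above_def)

text \<open>A lower bound for a value restricts the support to \<open>above L z\<close>; equality
  asks in addition that the support meet the corresponding face.\<close>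

lemma mem_fibre_cone_iff:
  "h \<in> meet_cone (above L z) (faces L z) \<longleftrightarrow> h \<in> power_series L \<and> (\<forall>(v, a)\<in>z. mon_val v h = enat a)"
proof -
  have 1: "h \<in> power_series (above L z) \<longleftrightarrow>
      h \<in> power_series L \<and> (\<forall>(v, a)\<in>z. \<forall>u. h u \<noteq> 0 \<longrightarrow> a \<le> wt v u)"
    unfolding power_series_def above_def by blast
  have 2: "(\<exists>u\<in>{u \<in> above L z. wt v u = a}. h u \<noteq> 0) \<longleftrightarrow> (\<exists>u. h u \<noteq> 0 \<and> wt v u = a)"
    if "h \<in> power_series (above L z)" for v a
    using that unfolding power_series_def by blast
  have "h \<in> meet_cone (above L z) (faces L z) \<longleftrightarrow>
      h \<in> power_series (above L z) \<and> (\<forall>(v, a)\<in>z. \<exists>u\<in>{u \<in> above L z. wt v u = a}. h u \<noteq> 0)"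
    by (simp add: meet_cone_def faces_def case_prod_beta)
  also have "\<dots> \<longleftrightarrow> h \<in> power_series (above L z) \<and> (\<forall>(v, a)\<in>z. \<exists>u. h u \<noteq> 0 \<and> wt v u = a)"
  proof (rule conj_cong[OF refl])
    assume h: "h \<in> power_series (above L z)"
    show "(\<forall>(v, a)\<in>z. \<exists>u\<in>{u \<in> above L z. wt v u = a}. h u \<noteq> 0) \<longleftrightarrow> (\<forall>(v, a)\<in>z. \<exists>u. h u \<noteq> 0 \<and> wt v u = a)"
      unfolding 2[OF h] ..
  qed
  finally show ?thesis unfolding mon_val_eq_iff 1 by (simp add: case_prod_beta ball_conj_distrib conj_assoc)
qed

text \<open>Passing from lists to sets of pairs is harmless: a repeated valuation with two different
  exponents gives incompatible conditions, and both sides are empty. The zero series is excluded by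
  any single finite value.\<close>

lemma fibre_t_nu:
  assumes "length as = length vs" "vs \<noteq> []"
  shows "fibre \<Lambda> (t_nu vs) (t_monomial as) = cls {} ` meet_cone (above \<Lambda> (set (zip vs as))) (faces \<Lambda> (set (zip vs as)))"
proof -
  have map: "map (\<lambda>v. the_enat (mon_val v h)) vs = as \<longleftrightarrow> (\<forall>(v, a)\<in>set (zip vs as). mon_val v h = enat a)"
    if "h \<noteq> (\<lambda>_. 0)" for h
  proof -
    have "map (\<lambda>v. the_enat (mon_val v h)) vs = as \<longleftrightarrow> (\<forall>i<length vs. mon_val (vs ! i) h = enat (as ! i))"
      using assms(1) the_enat_mon_val_eq_iff[OF that] by (simp add: list_eq_iff_nth_eq)
    also have "\<dots> \<longleftrightarrow> (\<forall>(v, a)\<in>set (zip vs as). mon_val v h = enat a)"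
      using assms(1) by (auto simp: set_zip; blast)
    finally show ?thesis .
  qed
  have "h \<noteq> (\<lambda>_. 0)" if "\<forall>(v, a)\<in>set (zip vs as). mon_val v h = enat a" for h
  proof -
    obtain v a where "(v, a) \<in> set (zip vs as)" using assms by (cases vs; cases as) auto
    then have "mon_val v h = enat a" using that by auto
    then show ?thesis unfolding mon_val_eq_iff by auto
  qed
  then have "h \<in> meet_cone (above \<Lambda> (set (zip vs as))) (faces \<Lambda> (set (zip vs as))) \<longleftrightarrow>
      h \<in> power_series \<Lambda> - {\<lambda>_. 0} \<and> t_nu vs (cls {} h) = t_monomial as" for h
    using map[of h] unfolding t_nu_proj_class t_monomial_inject mem_fibre_cone_iff by auto
  then show ?thesis unfolding fibre_def proj_space_zero by blast
qed

text \<open>A single monomial attains all the prescribed values at once.\<close>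

lemma level_imp_fibre_nonempty:
  assumes "u \<in> level \<Lambda> z"
  shows "(\<lambda>x. if x = u then 1 else 0) \<in> meet_cone (above \<Lambda> z) (faces \<Lambda> z)"
  unfolding mem_fibre_cone_iff mon_val_eq_iff using assms by (auto simp: level_def power_series_def)

lemma jet_map_proj_class:
  "jet_map \<Lambda> v k (cls {} h) = (if h \<in> power_series {u \<in> \<Lambda>. k + 1 \<le> wt v u} then None
     else Some (cls {u \<in> \<Lambda>. k + 1 \<le> wt v u} h))"
proof -
  let ?Q = "{u \<in> \<Lambda>. k + 1 \<le> wt v u}"
  have sub: "cls {} h \<subseteq> cls ?Q h"
  proof
    fix g assume "g \<in> cls {} h"
    then obtain c where "c \<noteq> 0" "g = (\<lambda>x. c * h x + 0)" by (auto simp: mem_proj_class_empty)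
    then show "g \<in> cls ?Q h" unfolding mem_proj_class_iff using power_series_zero by blast
  qed
  have "g \<in> power_series ?Q" if h: "h \<in> power_series ?Q" and g: "g \<in> cls {} h" for g
  proof -
    obtain c where "g = (\<lambda>x. c * h x)" using g by (auto simp: mem_proj_class_empty)
    then show ?thesis using h by (auto simp: power_series_def)
  qed
  then have "cls {} h \<subseteq> power_series ?Q \<longleftrightarrow> h \<in> power_series ?Q"
    using proj_class_self[of h "{}"] by blast
  moreover have "(\<Union>g\<in>cls {} h. cls ?Q g) = cls ?Q h"
    using sub proj_class_subset[of _ ?Q h] proj_class_self[of h "{}"] by blast
  ultimately show ?thesis by (simp add: jet_map_def val_ideal_eq Let_def)
qed

section \<open>The Euler characteristic of one fibre\<close>

context
  fixes \<Lambda> :: "(int ^ 'd::finite) set" and v1 :: "int ^ 'd" and z :: "((int ^ 'd) \<times> nat) set" and a1 :: nat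
  assumes v1: "real_vec v1 \<in> interior (sigma_cone \<Lambda>)" and z: "finite z" "(v1, a1) \<in> z"
begin

definition "low k = {u \<in> \<Lambda>. wt v1 u \<le> k}"
definition "high k = {u \<in> \<Lambda>. k + 1 \<le> wt v1 u}"
text \<open>Exponents in \<open>high k\<close> are free and occur in no face, so membership depends
  on the \<open>k\<close>-jet alone.\<close>

definition "jet_cone k = meet_cone (above (low k) z \<union> high k) (faces (low k) z)"

abbreviation "fcone L \<equiv> meet_cone (above L z) (faces L z)"

lemma finite_low: "finite (low k)"
  unfolding low_def by (rule finite_wt_le[OF v1])

lemma low_high: "low k \<union> high k = \<Lambda>" "low k \<inter> high k = {}"
  by (auto simp: low_def high_def)

lemma faces_low: "finite (faces (low k) z)" "faces (low k) z \<noteq> {}"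
  "T \<in> faces (low k) z \<Longrightarrow> finite T \<and> T \<subseteq> above (low k) z"
proof -
  show "finite (faces (low k) z)" "faces (low k) z \<noteq> {}" using z by (auto simp: faces_def)
  assume "T \<in> faces (low k) z"
  then have "T \<subseteq> above (low k) z" by (auto simp: faces_def)
  moreover have "above (low k) z \<subseteq> low k" by (auto simp: above_def)
  ultimately show "finite T \<and> T \<subseteq> above (low k) z" using finite_subset[OF _ finite_low[of k]] by blast
qed

lemma Inter_faces_context: "\<Inter>(faces L z) = level L z"
  using z by (intro Inter_faces) auto

lemma above_low: "above (low k) z \<subseteq> low k"
  by (auto simp: above_def)

lemma mem_jet_cone_iff:
  assumes "h \<in> power_series \<Lambda>"
  shows "h \<in> jet_cone k \<longleftrightarrow> (\<lambda>u. if u \<in> low k then h u else 0) \<in> fcone (low k)"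
proof -
  have "u \<in> low k" if "T \<in> faces (low k) z" "u \<in> T" for T u
    using that faces_low(3)[of T k] above_low[of k] by auto
  moreover have "h u \<noteq> 0 \<Longrightarrow> u \<in> low k \<or> u \<in> high k" for u
    using assms low_high(1)[of k] by (auto simp: power_series_def)
  ultimately show ?thesis using above_low[of k] low_high(2)[of k]
    unfolding jet_cone_def meet_cone_def power_series_def by (auto; fastforce)
qed

lemma jet_cone_subset: "jet_cone k \<subseteq> power_series \<Lambda> - power_series (high k)"
proof
  fix h assume h: "h \<in> jet_cone k"
  obtain T where T: "T \<in> faces (low k) z" using faces_low(2) by blast
  then obtain u where u: "u \<in> T" "h u \<noteq> 0" using h by (auto simp: jet_cone_def meet_cone_def)
  then have "u \<notin> high k" using faces_low(3)[OF T] above_low low_high(2) by blast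
  then have "h \<notin> power_series (high k)" using u by (auto simp: power_series_def)
  moreover have "h \<in> power_series (above (low k) z \<union> high k)" using h by (simp add: jet_cone_def meet_cone_def)
  moreover have "above (low k) z \<union> high k \<subseteq> \<Lambda>" using above_low low_high(1) by blast
  ultimately show "h \<in> power_series \<Lambda> - power_series (high k)" using power_series_mono by blast
qed

lemma saturated_jet_cone: "saturated (high k) (jet_cone k)"
  unfolding jet_cone_def
proof (rule saturated_meet_cone)
  show "T \<inter> high k = {}" if "T \<in> faces (low k) z" for T
    using faces_low(3)[OF that] above_low low_high(2) by blast
qed simp

lemma constructible_jet_cone:
  "constructible (power_series \<Lambda>) (val_ideal \<Lambda> v1 (k + 1)) (cls (high k) ` jet_cone k)"
  unfolding val_ideal_eq jet_cone_def high_def[symmetric]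
proof (rule constructible_meet_cone)
  show "above (low k) z \<union> high k \<subseteq> \<Lambda>" using above_low low_high(1) by blast
  show "finite (\<Lambda> - (above (low k) z \<union> high k))"
    using low_high(1) by (intro finite_subset[OF _ finite_low[of k]]) blast
  show "finite T \<and> T \<inter> high k = {}" if "T \<in> faces (low k) z" for T
    using faces_low(3)[OF that] above_low low_high(2) by blast
qed (auto simp: faces_low)

lemma euler_char_jet_cone:
  "euler_char_proj (power_series \<Lambda>) (val_ideal \<Lambda> v1 (k + 1)) (cls (high k) ` jet_cone k) = int (card (level (low k) z))"
proof -
  have "euler_char_proj (power_series \<Lambda>) (power_series (high k)) (cls (high k) ` jet_cone k) = int (card (\<Inter>(faces (low k) z)))"
    unfolding jet_cone_def
  proof (rule euler_char_proj_meet_cone)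
    show "above (low k) z \<union> high k \<subseteq> \<Lambda>" using above_low low_high(1) by blast
    show "finite T \<and> T \<subseteq> above (low k) z \<union> high k - high k" if "T \<in> faces (low k) z" for T
      using faces_low(3)[OF that] above_low low_high(2) by blast
  qed (auto simp: faces_low)
  then show ?thesis by (simp add: Inter_faces_context val_ideal_eq high_def)
qed

lemma fcone_truncate:
  assumes "h \<in> power_series (low k)" shows "h \<in> fcone \<Lambda> \<longleftrightarrow> h \<in> fcone (low k)"
  using assms power_series_mono[of "low k" \<Lambda>] by (auto simp: mem_fibre_cone_iff low_def)

lemma level_low: "a1 \<le> k \<Longrightarrow> level (low k) z = level \<Lambda> z"
  using z by (auto simp: level_def low_def)

text \<open>
  \<open>Y\<close> is determined by \<open>k\<close> and the cylinder, since a jet and its polynomial representative of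
  degree at most \<open>k\<close> have the same \<open>k\<close>-jet. If \<open>k < a1\<close> both the cylinder and the level set are empty.
\<close>

lemma cylinder_euler_char:
  assumes "is_cylinder_over \<Lambda> v1 (cls {} ` fcone \<Lambda>) k Y"
  shows "euler_char_proj (power_series \<Lambda>) (val_ideal \<Lambda> v1 (k + 1)) Y = int (card (level \<Lambda> z))"
proof -
  have Y: "constructible (power_series \<Lambda>) (power_series (high k)) Y"
    and X: "cls {} ` fcone \<Lambda> = {p \<in> PR \<Lambda>. jet_map \<Lambda> v1 k p \<in> Some ` Y}"
    using assms by (auto simp: is_cylinder_over_def val_ideal_eq high_def)
  note Ysub = constructible_subset[OF Y, unfolded proj_space_power_series]
  have sat: "saturated {} (fcone \<Lambda>)" by (rule saturated_meet_cone) auto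
  \<comment> \<open>Since fibres are unions of classes, the cylinder condition can be read off on
    individual series with non-zero \<open>k\<close>-jet.\<close>
  have key: "cls (high k) h \<in> Y \<longleftrightarrow> h \<in> fcone \<Lambda>" if "h \<in> power_series \<Lambda> - power_series (high k)" for h
  proof -
    have "h \<noteq> (\<lambda>_. 0)" using that power_series_zero by auto
    then have "cls {} h \<in> PR \<Lambda>"
      using that by (auto simp: proj_space_zero)
    then have "cls {} h \<in> cls {} ` fcone \<Lambda> \<longleftrightarrow> jet_map \<Lambda> v1 k (cls {} h) \<in> Some ` Y"
      unfolding X by simp
    moreover have "jet_map \<Lambda> v1 k (cls {} h) = Some (cls (high k) h)"
      using that by (simp add: jet_map_proj_class high_def)
    ultimately show ?thesis unfolding saturated_vimage[OF sat] by (simp add: image_iff)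
  qed
  have mem: "cls (high k) h \<in> Y \<longleftrightarrow> h \<in> jet_cone k" if h: "h \<in> power_series \<Lambda> - power_series (high k)" for h
  proof -
    define g where "g = (\<lambda>u. if u \<in> low k then h u else 0)"
    have "g \<in> cls (high k) h" unfolding mem_proj_class_iff
    proof (intro exI conjI)
      show "g = (\<lambda>u. 1 * h u + (if u \<in> low k then 0 else - h u))" by (auto simp: g_def)
      show "(\<lambda>u. if u \<in> low k then 0 else - h u) \<in> power_series (high k)"
        using h low_high(1)[of k] by (auto simp: power_series_def)
    qed simp
    then have eq: "cls (high k) g = cls (high k) h" by (simp add: proj_class_eq_iff)
    have g: "g \<in> power_series (low k)" by (simp add: g_def power_series_def)
    obtain u where "h u \<noteq> 0" "u \<in> \<Lambda>" "u \<notin> high k" using h by (auto simp: power_series_def)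
    then have "g u \<noteq> 0" "u \<notin> high k" using low_high(1)[of k] by (auto simp: g_def)
    then have "g \<in> power_series \<Lambda> - power_series (high k)"
      using g low_high(1)[of k] by (auto simp: power_series_def)
    from key[OF this] show ?thesis
      unfolding eq fcone_truncate[OF g] using mem_jet_cone_iff[of h k] h by (simp add: g_def)
  qed
  have Yeq: "Y = cls (high k) ` jet_cone k"
    using Ysub mem jet_cone_subset[of k] by blast
  have "level (low k) z = level \<Lambda> z"
  proof (cases "a1 \<le> k")
    \<comment> \<open>The face of \<open>v1\<close> contains no exponent of weight at most
      \<open>k\<close>, so \<open>Y\<close> and with it the fibre are empty; an exponent in
      \<open>level \<Lambda> z\<close> would put a monomial into that fibre.\<close>
    case False
    have "wt v1 u = a1" if "u \<in> level (low k) z" for u using that z(2) by (auto simp: level_def)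
    then have "level (low k) z = {}" using False by (fastforce simp: level_def low_def)
    moreover have "{u \<in> above (low k) z. wt v1 u = a1} \<in> faces (low k) z" using z by (force simp: faces_def)
    moreover have "{u \<in> above (low k) z. wt v1 u = a1} = {}" using False by (auto simp: above_def low_def)
    ultimately have "jet_cone k = {}" by (auto simp: jet_cone_def meet_cone_def)
    then have "fcone \<Lambda> = {}" using X Yeq by auto
    then have "level \<Lambda> z = {}" using level_imp_fibre_nonempty by blast
    then show ?thesis using \<open>level (low k) z = {}\<close> by simp
  qed (rule level_low)
  then show ?thesis using euler_char_jet_cone[of k] Yeq by simp
qed

text \<open>For a polynomial supported in \<open>low k\<close> the conditions involve only exponents
  there, so the fibre turns into the same kind of cone over a finite set.\<close>

lemma truncated_euler_char:
  fixes k :: nat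
  defines "A \<equiv> truncated_series \<Lambda> v1 k" and "Y \<equiv> cls {} ` fcone \<Lambda> \<inter> proj_space (truncated_series \<Lambda> v1 k) {\<lambda>_. 0}"
  shows "constructible A {\<lambda>_. 0} Y" "euler_char_proj A {\<lambda>_. 0} Y = int (card (level (low k) z))"
proof -
  have A: "A = power_series (low k)" by (simp add: A_def truncated_series_eq low_def)
  have sat: "saturated {} (fcone \<Lambda>)" by (rule saturated_meet_cone) auto
  have ne: "h \<noteq> (\<lambda>_. 0)" if "h \<in> fcone L" for h L
    using that z unfolding mem_fibre_cone_iff mon_val_eq_iff by auto
  have "Y = cls {} ` (fcone \<Lambda>) \<inter> cls {} ` (power_series (low k) - {\<lambda>_. 0})"
    unfolding Y_def using A A_def by (simp add: proj_space_zero)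
  also have "\<dots> = cls {} ` fcone (low k)"
  proof (intro equalityI subsetI)
    fix p assume "p \<in> cls {} ` (fcone \<Lambda>) \<inter> cls {} ` (power_series (low k) - {\<lambda>_. 0})"
    then obtain h where h: "h \<in> power_series (low k)" "p = cls {} h" "cls {} h \<in> cls {} ` fcone \<Lambda>" by auto
    then show "p \<in> cls {} ` fcone (low k)" using saturated_vimage[OF sat] fcone_truncate by auto
  next
    fix p assume "p \<in> cls {} ` fcone (low k)"
    then obtain h where h: "p = cls {} h" "h \<in> fcone (low k)" by auto
    moreover have "h \<in> power_series (low k)" using h by (auto simp: mem_fibre_cone_iff)
    ultimately show "p \<in> cls {} ` (fcone \<Lambda>) \<inter> cls {} ` (power_series (low k) - {\<lambda>_. 0})"
      using fcone_truncate ne by blast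
  qed
  finally have Y: "Y = cls {} ` fcone (low k)" .
  show "constructible A {\<lambda>_. 0} Y"
    unfolding A Y power_series_empty[symmetric]
  proof (rule constructible_meet_cone)
    show "above (low k) z \<subseteq> low k" by (rule above_low)
    show "finite (low k - above (low k) z)" using finite_low by auto
    show "finite T \<and> T \<inter> {} = {}" if "T \<in> faces (low k) z" for T using faces_low(3)[OF that] by simp
  qed (auto simp: faces_low)
  show "euler_char_proj A {\<lambda>_. 0} Y = int (card (level (low k) z))"
  proof -
    have "euler_char_proj (power_series (low k)) (power_series {}) (cls {} ` fcone (low k)) = int (card (\<Inter>(faces (low k) z)))"
    proof (rule euler_char_proj_meet_cone)
      show "above (low k) z \<subseteq> low k" by (rule above_low)
      show "finite T \<and> T \<subseteq> above (low k) z - {}" if "T \<in> faces (low k) z" for T using faces_low(3)[OF that] by simp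
    qed (auto simp: faces_low)
    then show ?thesis unfolding A Y power_series_empty[symmetric] by (simp add: Inter_faces_context)
  qed
qed

text \<open>A cylinder over any \<open>k\<close> has this value, and from \<open>k = a1\<close> on
  so does every truncation; the answer is thus the same in both branches of
  \<open>chi_PR\<close>.\<close>

lemma chi_PR_fibre: "chi_PR \<Lambda> v1 (cls {} ` fcone \<Lambda>) = int (card (level \<Lambda> z))"
proof (cases "cylindric \<Lambda> v1 (cls {} ` fcone \<Lambda>)")
  case True
  then obtain k Y where "is_cylinder_over \<Lambda> v1 (cls {} ` fcone \<Lambda>) k Y" by (auto simp: cylindric_def)
  then have "chi_cyl \<Lambda> v1 (cls {} ` fcone \<Lambda>) = int (card (level \<Lambda> z))"
    unfolding chi_cyl_def using cylinder_euler_char by (intro the_equality) metis+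
  with True show ?thesis by (simp add: chi_PR_def)
next
  case False
  let ?P = "\<lambda>e k. let A = truncated_series \<Lambda> v1 k; Y = cls {} ` fcone \<Lambda> \<inter> proj_space A {\<lambda>_. 0} in
        constructible A {\<lambda>_. 0} Y \<and> euler_char_proj A {\<lambda>_. 0} Y = e"
  have P: "?P e k \<longleftrightarrow> e = int (card (level \<Lambda> z))" if "k \<ge> a1" for e k
    using truncated_euler_char[of k] level_low[OF that] by (auto simp: Let_def)
  have "(THE e. \<forall>\<^sub>F k in sequentially. ?P e k) = int (card (level \<Lambda> z))"
  proof (rule the_equality)
    show "\<forall>\<^sub>F k in sequentially. ?P (int (card (level \<Lambda> z))) k"
      using eventually_ge_at_top[of a1] by eventually_elim (use P in blast)
    \<comment> \<open>Two values that both hold eventually hold at a common \<open>k\<close>, which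
      gives uniqueness.\<close>
    show "e = int (card (level \<Lambda> z))" if "\<forall>\<^sub>F k in sequentially. ?P e k" for e
    proof -
      have "\<forall>\<^sub>F k in sequentially. e = int (card (level \<Lambda> z))"
        using that eventually_ge_at_top[of a1] by eventually_elim (use P in blast)
      then show ?thesis by simp
    qed
  qed
  with False show ?thesis by (simp add: chi_PR_def chi_trunc_def)
qed

text \<open>If all valuations are centered, only finitely many exponents have weight at most the
  prescribed value for some valuation. Any \<open>k\<close> bounding their \<open>v1\<close>-weights
  works, since the \<open>k\<close>-jet then decides every condition.\<close>

lemma cylindric_fibre:
  assumes "\<forall>(v, a)\<in>z. real_vec v \<in> interior (sigma_cone \<Lambda>)"
  shows "cylindric \<Lambda> v1 (cls {} ` fcone \<Lambda>)"
proof -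
  define F where "F = (\<Union>(v, a)\<in>z. {u \<in> \<Lambda>. wt v u \<le> a})"
  have "finite F" unfolding F_def
  proof (intro finite_UN_I z(1))
    fix va assume "va \<in> z"
    then show "finite (case va of (v, a) \<Rightarrow> {u \<in> \<Lambda>. wt v u \<le> a})"
      using assms by (cases va) (auto intro!: finite_wt_le)
  qed
  then obtain k where k: "\<And>u. u \<in> F \<Longrightarrow> wt v1 u \<le> k"
    using finite_nat_set_iff_bounded_le[of "wt v1 ` F"] by auto
  have sat: "saturated {} (fcone \<Lambda>)" by (rule saturated_meet_cone) auto
  have jet: "h \<in> fcone \<Lambda> \<longleftrightarrow> h \<in> jet_cone k" if h: "h \<in> power_series \<Lambda>" for h
  proof -
    have lo: "u \<in> low k" if "u \<in> \<Lambda>" "(v, a) \<in> z" "wt v u \<le> a" for u v a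
      using that k[of u] by (force simp: F_def low_def)
    \<comment> \<open>An exponent outside \<open>low k\<close> has weight greater than
      \<open>a\<close>, so it neither violates the lower bound nor attains it.\<close>
    have *: "(\<forall>u. h u \<noteq> 0 \<longrightarrow> a \<le> wt v u) \<and> (\<exists>u. h u \<noteq> 0 \<and> wt v u = a) \<longleftrightarrow>
        (\<forall>u. u \<in> low k \<and> h u \<noteq> 0 \<longrightarrow> a \<le> wt v u) \<and> (\<exists>u. u \<in> low k \<and> h u \<noteq> 0 \<and> wt v u = a)"
      if va: "(v, a) \<in> z" for v a
    proof -
      have "h u \<noteq> 0 \<Longrightarrow> wt v u \<le> a \<Longrightarrow> u \<in> low k" for u
        using lo[OF _ va] h by (auto simp: power_series_def)
      then show ?thesis by (metis le_cases order_refl)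
    qed
    have eq: "(\<forall>(v, a)\<in>z. mon_val v h = enat a) \<longleftrightarrow> (\<forall>(v, a)\<in>z. mon_val v (\<lambda>u. if u \<in> low k then h u else 0) = enat a)"
    proof -
      have "(if u \<in> low k then h u else 0) \<noteq> 0 \<longleftrightarrow> u \<in> low k \<and> h u \<noteq> 0" for u by simp
      then have "mon_val v h = enat a \<longleftrightarrow> mon_val v (\<lambda>u. if u \<in> low k then h u else 0) = enat a"
        if "(v, a) \<in> z" for v a
        unfolding mon_val_eq_iff using that * by (simp add: conj_assoc)
      then show ?thesis by blast
    qed
    have "(\<lambda>u. if u \<in> low k then h u else 0) \<in> power_series (low k)" by (simp add: power_series_def)
    then show ?thesis unfolding mem_jet_cone_iff[OF h] mem_fibre_cone_iff using eq h by simp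
  qed
  have PR: "PR \<Lambda> = cls {} ` (power_series \<Lambda> - {\<lambda>_. 0})"
    by (rule proj_space_zero)
  have "cls {} ` fcone \<Lambda> = {p \<in> PR \<Lambda>. jet_map \<Lambda> v1 k p \<in> Some ` cls (high k) ` jet_cone k}"
  proof -
    have iff: "jet_map \<Lambda> v1 k (cls {} h) \<in> Some ` cls (high k) ` jet_cone k \<longleftrightarrow> h \<in> jet_cone k"
      if "h \<in> power_series \<Lambda>" for h
    proof -
      have "jet_map \<Lambda> v1 k (cls {} h) \<in> Some ` cls (high k) ` jet_cone k \<longleftrightarrow>
          h \<notin> power_series (high k) \<and> cls (high k) h \<in> cls (high k) ` jet_cone k"
        unfolding jet_map_proj_class high_def by auto
      then show ?thesis
        unfolding saturated_vimage[OF saturated_jet_cone] using jet_cone_subset[of k] by blast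
    qed
    have "fcone \<Lambda> \<subseteq> power_series \<Lambda> - {\<lambda>_. 0}"
      using z by (auto simp: mem_fibre_cone_iff mon_val_eq_iff)
    then show ?thesis unfolding PR using iff jet by auto
  qed
  then show ?thesis
    unfolding cylindric_def is_cylinder_over_def using constructible_jet_cone[of k] by blast
qed

end

section \<open>Comparison of the coefficients\<close>

lemma finite_level:
  assumes "real_vec v1 \<in> interior (sigma_cone (\<Lambda> :: (int ^ 'd::finite) set))" "(v1, a1) \<in> z"
  shows "finite (level \<Lambda> z)"
  using assms(2) by (intro finite_subset[OF _ finite_wt_le[OF assms(1), of a1]]) (auto simp: level_def)

text \<open>A whole projective space is the case of a single face \<open>P - Q\<close>: some
  coordinate outside \<open>Q\<close> is non-zero. The general count then yields its dimension as a
  vector space.\<close>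

lemma poincare_series_eq:
  fixes \<Lambda> :: "(int ^ 'd::finite) set"
  assumes "vs \<noteq> []" "real_vec (hd vs) \<in> interior (sigma_cone \<Lambda>)" "length as = length vs"
  shows "poincare_series \<Lambda> vs as = int (card (level \<Lambda> (set (zip vs as))))"
proof -
  obtain P Q where PQ: "gr_component \<Lambda> vs as = (power_series P, power_series Q)" "Q \<subseteq> P"
    "P - Q = level \<Lambda> (set (zip vs as))"
    using fold_gr_step[of "{}" \<Lambda> "zip vs as"] by (auto simp: gr_component_def power_series_empty level_def)
  have "(hd vs, hd as) \<in> set (zip vs as)" using assms by (cases vs; cases as) auto
  then have fin: "finite (P - Q)" unfolding PQ(3) by (rule finite_level[OF assms(2)])
  have "power_series P - power_series Q = meet_cone P {P - Q}"
    by (auto simp: meet_cone_def power_series_def)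
  then have "proj_space (power_series P) (power_series Q) = cls Q ` meet_cone P {P - Q}"
    by (simp add: proj_space_power_series)
  then have "euler_char_proj (power_series P) (power_series Q) (proj_space (power_series P) (power_series Q)) = int (card (P - Q))"
    using euler_char_proj_meet_cone[of Q P P "{P - Q}"] PQ(2) fin by simp
  then show ?thesis using assms(3) PQ by (simp add: poincare_series_def)
qed

lemma t_nu_image:
  "g \<in> t_nu vs ` PR \<Lambda> \<Longrightarrow> \<exists>as. length as = length vs \<and> g = t_monomial as"
  unfolding proj_space_zero using t_nu_proj_class by (metis (no_types, lifting) imageE length_map)

text \<open>The last conjunct shows that for centered valuations every fibre over a non-zero value
  is measured by the cylindric branch of \<open>chi_PR\<close>; the truncated branch matters only
  for the others.\<close>

theorem theorem5p7:
  fixes \<Lambda> :: "(int ^ 'd::finite) set" and vs :: "(int ^ 'd) list"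
  assumes "fg_semigroup \<Lambda>"
    and "{a - b | a b. a \<in> \<Lambda> \<and> b \<in> \<Lambda>} = UNIV"
    and "\<exists>x. x extreme_point_of sigma_dual \<Lambda>"
    and "vs \<noteq> []"
    and "\<forall>v\<in>set vs. v \<noteq> 0 \<and> real_vec v \<in> sigma_cone \<Lambda>"
    and "real_vec (hd vs) \<in> interior (sigma_cone \<Lambda>)"
  shows "euler_summable \<Lambda> (hd vs) (t_nu vs)
    \<and> poincare_series \<Lambda> vs = euler_integral \<Lambda> (hd vs) (t_nu vs)
    \<and> ((\<forall>v\<in>set vs. real_vec v \<in> interior (sigma_cone \<Lambda>)) \<longrightarrow> cylindric_fun \<Lambda> (hd vs) (t_nu vs))"
proof (intro conjI impI)
  let ?C = "contributing_values \<Lambda> (hd vs) (t_nu vs)"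
  \<comment> \<open>Values of \<open>t_nu vs\<close> are single monomials, so only
    \<open>t_monomial as\<close> has a non-zero coefficient at \<open>as\<close>. Summability
    follows.\<close>
  have C: "?C as \<subseteq> {t_monomial as}" "length as \<noteq> length vs \<Longrightarrow> ?C as = {}" for as
  proof -
    have "g = t_monomial as \<and> length as = length vs" if g: "g \<in> ?C as" for g
    proof -
      obtain bs where bs: "length bs = length vs" "g = t_monomial bs"
        using g t_nu_image by (force simp: contributing_values_def)
      moreover have "g as \<noteq> 0" using g by (auto simp: contributing_values_def)
      ultimately show ?thesis by (auto simp: t_monomial_def split: if_splits)
    qed
    then show "?C as \<subseteq> {t_monomial as}" "length as \<noteq> length vs \<Longrightarrow> ?C as = {}" by blast+
  qed
  then show "euler_summable \<Lambda> (hd vs) (t_nu vs)"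
    unfolding euler_summable_def by (meson finite.emptyI finite_insert finite_subset)
  have hd: "(hd vs, hd as) \<in> set (zip vs as)" if "length as = length vs" for as :: "nat list"
    using that assms(4) by (cases vs; cases as) auto
  show "poincare_series \<Lambda> vs = euler_integral \<Lambda> (hd vs) (t_nu vs)"
  proof
    fix as
    show "poincare_series \<Lambda> vs as = euler_integral \<Lambda> (hd vs) (t_nu vs) as"
    proof (cases "length as = length vs")
      case False
      then show ?thesis using C(2) by (simp add: poincare_series_def euler_integral_def)
    next
      case True
      define z where "z = set (zip vs as)"
      have fib: "fibre \<Lambda> (t_nu vs) (t_monomial as) = cls {} ` meet_cone (above \<Lambda> z) (faces \<Lambda> z)"
        unfolding z_def by (rule fibre_t_nu[OF True assms(4)])
      have chi: "chi_PR \<Lambda> (hd vs) (fibre \<Lambda> (t_nu vs) (t_monomial as)) = int (card (level \<Lambda> z))"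
        unfolding fib by (rule chi_PR_fibre[OF assms(6)]) (use hd[OF True] in \<open>auto simp: z_def\<close>)
      have "euler_integral \<Lambda> (hd vs) (t_nu vs) as = int (card (level \<Lambda> z))"
      \<comment> \<open>With an empty level set the product of measure and coefficient is 0, whether
        or not the value is taken; otherwise the fibre must be shown non-empty for the value to
        enter the sum.\<close>
      proof (cases "card (level \<Lambda> z) = 0")
        case True
        then have "?C as = {}" using C(1)[of as] chi by (auto simp: contributing_values_def)
        then show ?thesis using True by (simp add: euler_integral_def)
      next
        case False
        then obtain u where "u \<in> level \<Lambda> z" by (metis card.empty ex_in_conv)
        then have "fibre \<Lambda> (t_nu vs) (t_monomial as) \<noteq> {}"
          unfolding fib using level_imp_fibre_nonempty by blast
        then obtain p where "p \<in> PR \<Lambda>" "t_nu vs p = t_monomial as" by (auto simp: fibre_def)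
        then have "t_monomial as \<in> t_nu vs ` PR \<Lambda>" by (metis imageI)
        then have "t_monomial as \<in> ?C as"
          using False chi by (simp add: contributing_values_def t_monomial_nonzero) (simp add: t_monomial_def)
        then have "?C as = {t_monomial as}" using C(1)[of as] by auto
        then show ?thesis using chi by (simp add: euler_integral_def) (simp add: t_monomial_def)
      qed
      then show ?thesis using poincare_series_eq[OF assms(4,6) True] by (simp add: z_def)
    qed
  qed
  assume int: "\<forall>v\<in>set vs. real_vec v \<in> interior (sigma_cone \<Lambda>)"
  show "cylindric_fun \<Lambda> (hd vs) (t_nu vs)"
    unfolding cylindric_fun_def
  proof (intro allI impI)
    fix g :: multi_series
    show "cylindric \<Lambda> (hd vs) (fibre \<Lambda> (t_nu vs) g)"
    \<comment> \<open>A value not taken by the function has an empty fibre, which is the cylinder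
      over the empty set; all other values are monomials.\<close>
    proof (cases "fibre \<Lambda> (t_nu vs) g = {}")
      case True
      then show ?thesis unfolding cylindric_def is_cylinder_over_def
        using constructible_empty by (intro exI[of _ 0] exI[of _ "{}"]) auto
    next
      case False
      then have "g \<in> t_nu vs ` PR \<Lambda>" by (auto simp: fibre_def)
      then obtain as where as: "length as = length vs" "g = t_monomial as" using t_nu_image by blast
      show ?thesis unfolding as(2) fibre_t_nu[OF as(1) assms(4)]
        by (rule cylindric_fibre[OF assms(6)]) (use hd[OF as(1)] int in \<open>auto dest: set_zip_leftD\<close>)
    qed
  qed
qed

end
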